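(* Let $\delta>0$ and let $p,q$ be positive integers. Let $u$ be the solution of the periodic Riemann problem for the linearised Smith equation, i.e. $$u(t,x)=\frac12+\frac2\pi\sum_{j=0}^\infty\frac{\sin\left[(2j+1)x-\omega_S(2j+1)t\right]}{2j+1},\qquad \omega_S(k)=k\sqrt{\frac1\delta+k^2}.$$ Then, for almost every $x$, $$\begin{aligned}u\left(\frac{p\pi}{q},x\right)={}&\frac12+\frac2\pi\cos\left(\frac{p\pi}{2q\delta}\right)\sum_{j=0}^{q-1}S^{2q}_{2j+1,1}(x_j)-\frac2\pi\sin\left(\frac{p\pi}{2q\delta}\right)\sum_{j=0}^{q-1}C^{2q}_{2j+1,1}(x_j)\\&+\frac{p}{4q\delta^2}\cos\left(\frac{p\pi}{2q\delta}\right)\sum_{j=0}^{q-1}C^{2q}_{2j+1,3}(x_j)+\frac{p}{4q\delta^2}\sin\left(\frac{p\pi}{2q\delta}\right)\sum_{j=0}^{q-1}S^{2q}_{2j+1,3}(x_j)+\mathrm{error}(x),\end{aligned}$$ where $x_j=x-\frac{(2j+1)p\pi}{q}$, and the function $\mathrm{error}$ belongs to $C^3_{\mathrm{per}}[-\pi,\pi]$ and satisfies, for all $x$, $$|\mathrm{error}(x)|<\frac{p\,\zeta(5)}{2q\delta^3}\left(1+\frac{p\pi}{8q\delta}\right).$$ Consequently $u(p\pi/q,\cdot)$ is (after modification on a null set) at least $C^3$ away from the nodes $x=\pi l/q$, $l\in\mathbb Z$.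
   Context: The periodic Riemann problem is the $2\pi$-periodic initial value problem on $(-\pi,\pi)$ with initial datum the unit step $u(0,x)=\frac12(1+\mathrm{sgn}\,x)$. The series for $u(t,\cdot)$ is understood as an $L^2(-\pi,\pi)$-convergent Fourier series. $\zeta$ is the Riemann zeta function. $C^3_{\mathrm{per}}[-\pi,\pi]$ is the space of $2\pi$-periodic functions that are three times continuously differentiable with periodic derivatives. For positive integers $j,k,r$ with $j\le k$, the trigonometric polylogarithms are $$S^k_{j,r}(x)=\sum_{n=0}^\infty\frac{\sin[(nk+j)x]}{(nk+j)^r},\qquad C^k_{j,r}(x)=\sum_{n=0}^\infty\frac{\cos[(nk+j)x]}{(nk+j)^r},$$ defined for all real $x$ if $r\ge2$, and for $x$ other than the nodes $x=2\pi l/k$, $l\in\mathbb Z$, if $r=1$. *)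

theory Defs
  imports "HOL-Analysis.Analysis"
begin

(* For r = 1 and x = 2*pi*l/k the series below need not converge, and suminf then returns an
   unspecified value.  Away from these nodes, and for all x if r >= 2, suminf is the usual
   limit of the (for r = 1 only conditionally convergent) partial sums. *)

definition polylog_S :: "nat \<Rightarrow> nat \<Rightarrow> nat \<Rightarrow> real \<Rightarrow> real" where
  "polylog_S k j r x = (\<Sum>n. sin (real (n * k + j) * x) / real (n * k + j) ^ r)"

definition polylog_C :: "nat \<Rightarrow> nat \<Rightarrow> nat \<Rightarrow> real \<Rightarrow> real" where
  "polylog_C k j r x = (\<Sum>n. cos (real (n * k + j) * x) / real (n * k + j) ^ r)"

(* The Riemann zeta function on real arguments s > 1; meaningless for other s. *)

definition zeta :: "real \<Rightarrow> real" where
  "zeta s = (\<Sum>n. 1 / real (Suc n) powr s)"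

definition omega_Smith :: "real \<Rightarrow> real \<Rightarrow> real" where
  "omega_Smith \<delta> k = k * sqrt (1 / \<delta> + k ^ 2)"

definition L2_periodic :: "(real \<Rightarrow> real) \<Rightarrow> bool" where
  "L2_periodic f \<longleftrightarrow>
     (\<forall>x. f (x + 2 * pi) = f x) \<and>
     f \<in> borel_measurable lebesgue \<and>
     set_integrable lebesgue {-pi<..<pi} (\<lambda>x. (f x)\<^sup>2)"

definition riemann_partial_sum :: "(real \<Rightarrow> real) \<Rightarrow> nat \<Rightarrow> real \<Rightarrow> real \<Rightarrow> real" where
  "riemann_partial_sum \<omega> N t x =
     1 / 2 + 2 / pi *
       (\<Sum>j<N. sin (real (2 * j + 1) * x - \<omega> (real (2 * j + 1)) * t) / real (2 * j + 1))"

(* Solution of the periodic Riemann problem for the equation with dispersion relation \<omega>: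
   at every time, the sum of the Fourier series in L2(-pi,pi).  At t = 0 this is the Fourier
   series of the unit step (1 + sgn x) / 2.  Each u t is determined only up to a null set,
   so u stands for an arbitrary choice of representatives. *)

definition periodic_riemann_solution ::
    "(real \<Rightarrow> real) \<Rightarrow> (real \<Rightarrow> real \<Rightarrow> real) \<Rightarrow> bool" where
  "periodic_riemann_solution \<omega> u \<longleftrightarrow>
     (\<forall>t\<ge>0. L2_periodic (u t) \<and>
       (\<lambda>N. LINT x:{-pi<..<pi}|lebesgue. (u t x - riemann_partial_sum \<omega> N t x)\<^sup>2)
         \<longlonglongrightarrow> 0)"

(* To be used for open A only, since deriv is the two-sided derivative. *)

definition Ck_on :: "nat \<Rightarrow> (real \<Rightarrow> real) \<Rightarrow> real set \<Rightarrow> bool" where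
  "Ck_on k f A \<longleftrightarrow>
     (\<forall>i<k. (deriv ^^ i) f differentiable_on A) \<and> continuous_on A ((deriv ^^ k) f)"

definition Ck_per :: "nat \<Rightarrow> (real \<Rightarrow> real) set" where
  "Ck_per k = {f. Ck_on k f UNIV \<and>
     (\<forall>i\<le>k. \<forall>x. (deriv ^^ i) f (x + 2 * pi) = (deriv ^^ i) f x)}"

end

(*
  At t = p pi / q the frequencies n = 2 q m + 2 j + 1 satisfy n x - n^2 t = n (x_j) mod 2 pi, so the
  leading part n^2 of omega_S(n) = n^2 + 1/(2 delta) - 1/(8 delta^2 n^2) + O(n^-4) only shifts x
  within each residue class j, and the constant 1/(2 delta) gives the phase p pi / (2 q delta).
  Linearising in the remaining phase O(n^-2) yields the polylogarithms of order 1 and 3, and an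
  error series with coefficients O(n^-5), which is C^3.  The partial sums converge pointwise off the
  nodes along N = M q; together with L^2 convergence this identifies u almost everywhere.
  Smoothness off the nodes: the order-1 polylogarithm has the elementary derivative
  i cis(j x) / (1 - cis(k x)), and those of order 2 and 3 are its successive primitives.
*)

theory Submission
  imports Defs
begin

text \<open>The obstacle is order 1. At a node the partial sums diverge, near it they do not
  converge uniformly, and termwise differentiation yields the divergent series of
  \<open>cis (w x)\<close>. All limits are therefore taken after multiplication by powers of
  \<open>1 - cis (k x)\<close>, which vanishes exactly at the nodes: convergence becomes uniform on
  the whole real line with an explicit rate, so one global theorem on limits of derivatives is
  enough, and the division happens afterwards on the open complement of the nodes. Order 1 takes two
  such factors, order 2 takes one, order 3 none. Complex series treat sine and cosine together and
  turn the splitting of the phase into a factorisation of \<open>cis\<close>. The strict inequality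
  for the error needs no delicate estimate: with T = p pi / q the argument gives T / (8 pi
  \<delta>^3) (1 + T / (4 \<delta>)) times the sum of n^-5 over odd n, and the constant claimed is
  larger.\<close>

section \<open>Functions with continuous derivatives\<close>

text \<open>\<open>has_derivative_sequence\<close> only provides some differentiable limit function;
  the pointwise limits identify it with \<open>g\<close>. The bound \<open>\<epsilon> N\<close> may
  not depend on \<open>x\<close>, and this is what later forces the factors
  \<open>1 - cis (k x)\<close>.\<close>

lemma has_vector_derivative_uniform_limit:
  fixes f :: "nat \<Rightarrow> real \<Rightarrow> 'a::banach"
  assumes der: "\<And>N x. (f N has_vector_derivative f' N x) (at x)"
    and bound: "\<And>N x. norm (f' N x - g' x) \<le> \<epsilon> N"
    and \<epsilon>: "\<epsilon> \<longlonglongrightarrow> 0"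
    and lim: "\<And>x. (\<lambda>N. f N x) \<longlonglongrightarrow> g x"
  shows "(g has_vector_derivative g' x) (at x)"
proof -
  have "\<exists>h. \<forall>x\<in>UNIV. (\<lambda>N. f N x) \<longlonglongrightarrow> h x \<and> (h has_derivative (\<lambda>t. t *\<^sub>R g' x)) (at x within UNIV)"
  proof (rule has_derivative_sequence[where f' = "\<lambda>N x t. t *\<^sub>R f' N x"])
    show "(f N has_derivative (\<lambda>t. t *\<^sub>R f' N x)) (at x within UNIV)" for N x
      using der by (simp add: has_vector_derivative_def)
    show "(\<lambda>N. f N 0) \<longlonglongrightarrow> g 0" by (rule lim)
    fix e :: real assume "e > 0"
    then have "\<forall>\<^sub>F N in sequentially. \<epsilon> N < e"
      using order_tendstoD(2)[OF \<epsilon>] by blast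
    then show "\<forall>\<^sub>F N in sequentially. \<forall>x\<in>UNIV. \<forall>t. norm (t *\<^sub>R f' N x - t *\<^sub>R g' x) \<le> e * norm t"
    proof eventually_elim
      case (elim N)
      have "norm (t *\<^sub>R f' N x - t *\<^sub>R g' x) \<le> e * norm t" for x t
      proof -
        have "norm (t *\<^sub>R f' N x - t *\<^sub>R g' x) = norm (f' N x - g' x) * norm t"
          by (simp flip: scaleR_diff_right)
        also have "\<dots> \<le> e * norm t"
          using bound[of N x] elim by (intro mult_right_mono) auto
        finally show ?thesis .
      qed
      then show ?case by blast
    qed
  qed auto
  then obtain h where h: "\<And>x. (\<lambda>N. f N x) \<longlonglongrightarrow> h x"
    "\<And>x. (h has_vector_derivative g' x) (at x)"
    by (auto simp: has_vector_derivative_def)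
  have "h = g"
    using h(1) lim LIMSEQ_unique by blast
  with h show ?thesis by simp
qed

lemma has_vector_derivative_cis_linear:
  "((\<lambda>x. cis (w * x)) has_vector_derivative \<i> * of_real w * cis (w * x)) (at x)"
  unfolding has_vector_derivative_def
  by (auto intro!: derivative_eq_intros simp: scaleR_conv_of_real algebra_simps)

text \<open>Derivatives enter as existential witnesses instead of iterates of \<open>deriv\<close>,
  so the closure properties follow by induction from the usual rules, and complex-valued functions
  are covered.\<close>

primrec cont_diff :: "nat \<Rightarrow> (real \<Rightarrow> 'a::real_normed_vector) \<Rightarrow> real set \<Rightarrow> bool" where
  "cont_diff 0 f A = continuous_on A f"
| "cont_diff (Suc n) f A =
     (\<exists>f'. (\<forall>x\<in>A. (f has_vector_derivative f' x) (at x)) \<and> cont_diff n f' A)"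

lemma cont_diff_SucI:
  assumes "\<And>x. x \<in> A \<Longrightarrow> (f has_vector_derivative f' x) (at x)" "cont_diff n f' A"
  shows "cont_diff (Suc n) f A"
  using assms by auto

lemma cont_diff_SucE:
  assumes "cont_diff (Suc n) f A"
  obtains f' where "\<And>x. x \<in> A \<Longrightarrow> (f has_vector_derivative f' x) (at x)" "cont_diff n f' A"
  using assms by auto

lemma cont_diff_imp_continuous_on:
  assumes "cont_diff n f A"
  shows "continuous_on A f"
proof (cases n)
  case 0
  with assms show ?thesis by simp
next
  case (Suc m)
  with assms obtain f' where "\<And>x. x \<in> A \<Longrightarrow> (f has_vector_derivative f' x) (at x)"
    by (auto elim: cont_diff_SucE)
  then show ?thesis
    by (meson continuous_at_imp_continuous_on has_vector_derivative_continuous)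
qed

lemma cont_diff_Suc_imp: "cont_diff (Suc n) f A \<Longrightarrow> cont_diff n f A"
proof (induction n arbitrary: f)
  case 0
  then show ?case using cont_diff_imp_continuous_on by fastforce
next
  case (Suc n)
  then show ?case by (metis cont_diff.simps(2))
qed

lemma cont_diff_cong:
  assumes "open A" "\<And>x. x \<in> A \<Longrightarrow> f x = g x" "cont_diff n f A"
  shows "cont_diff n g A"
proof (cases n)
  case 0
  then show ?thesis using assms continuous_on_cong by fastforce
next
  case (Suc m)
  with assms(3) obtain f' where
    f': "\<And>x. x \<in> A \<Longrightarrow> (f has_vector_derivative f' x) (at x)" "cont_diff m f' A"
    by (auto elim: cont_diff_SucE)
  have "(g has_vector_derivative f' x) (at x)" if "x \<in> A" for x
    using has_vector_derivative_transform_within_open[OF f'(1)[OF that] assms(1) that] assms(2)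
    by blast
  then show ?thesis
    unfolding Suc using f'(2) by (rule cont_diff_SucI)
qed

lemma cont_diff_const: "cont_diff n (\<lambda>x. c) A"
proof (induction n arbitrary: c)
  case (Suc n)
  show ?case
    by (rule cont_diff_SucI[OF has_vector_derivative_const Suc])
qed simp

lemma cont_diff_add:
  "cont_diff n f A \<Longrightarrow> cont_diff n g A \<Longrightarrow> cont_diff n (\<lambda>x. f x + g x) A"
proof (induction n arbitrary: f g)
  case 0
  then show ?case by (auto intro: continuous_on_add)
next
  case (Suc n)
  obtain f' where f': "\<And>x. x \<in> A \<Longrightarrow> (f has_vector_derivative f' x) (at x)" "cont_diff n f' A"
    using Suc.prems(1) by (auto elim: cont_diff_SucE)
  obtain g' where g': "\<And>x. x \<in> A \<Longrightarrow> (g has_vector_derivative g' x) (at x)" "cont_diff n g' A"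
    using Suc.prems(2) by (auto elim: cont_diff_SucE)
  show ?case
    by (rule cont_diff_SucI[OF has_vector_derivative_add[OF f'(1) g'(1)] Suc.IH[OF f'(2) g'(2)]])
qed

lemma cont_diff_mult:
  fixes f g :: "real \<Rightarrow> 'a::real_normed_algebra"
  shows "cont_diff n f A \<Longrightarrow> cont_diff n g A \<Longrightarrow> cont_diff n (\<lambda>x. f x * g x) A"
proof (induction n arbitrary: f g)
  case 0
  then show ?case by (auto intro: continuous_on_mult)
next
  case (Suc n)
  obtain f' where f': "\<And>x. x \<in> A \<Longrightarrow> (f has_vector_derivative f' x) (at x)" "cont_diff n f' A"
    using Suc.prems(1) by (auto elim: cont_diff_SucE)
  obtain g' where g': "\<And>x. x \<in> A \<Longrightarrow> (g has_vector_derivative g' x) (at x)" "cont_diff n g' A"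
    using Suc.prems(2) by (auto elim: cont_diff_SucE)
  have H: "cont_diff n (\<lambda>x. f x * g' x + f' x * g x) A"
    by (intro cont_diff_add Suc.IH f'(2) g'(2) Suc.prems[THEN cont_diff_Suc_imp])
  show ?case
    by (rule cont_diff_SucI[OF has_vector_derivative_mult[OF f'(1) g'(1)] H])
qed

lemma cont_diff_sum:
  "(\<And>i. i \<in> I \<Longrightarrow> cont_diff n (f i) A) \<Longrightarrow> cont_diff n (\<lambda>x. \<Sum>i\<in>I. f i x) A"
  by (induction I rule: infinite_finite_induct) (simp_all add: cont_diff_const cont_diff_add)

lemma cont_diff_bounded_linear:
  assumes "bounded_linear L"
  shows "cont_diff n f A \<Longrightarrow> cont_diff n (\<lambda>x. L (f x)) A"
proof (induction n arbitrary: f)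
  case 0
  then show ?case
    by (simp add: bounded_linear.continuous_on[OF assms])
next
  case (Suc n)
  obtain f' where f': "\<And>x. x \<in> A \<Longrightarrow> (f has_vector_derivative f' x) (at x)" "cont_diff n f' A"
    using Suc.prems by (auto elim: cont_diff_SucE)
  show ?case
    by (rule cont_diff_SucI[OF bounded_linear.has_vector_derivative[OF assms f'(1)] Suc.IH[OF f'(2)]])
qed

text \<open>The derivative is a product of \<open>inverse f\<close> and \<open>f'\<close> only, so
  the induction hypothesis for the same \<open>f\<close> suffices.\<close>

lemma cont_diff_inverse:
  fixes f :: "real \<Rightarrow> 'a::real_normed_field"
  assumes "\<And>x. x \<in> A \<Longrightarrow> f x \<noteq> 0"
  shows "cont_diff n f A \<Longrightarrow> cont_diff n (\<lambda>x. inverse (f x)) A"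
proof (induction n)
  case 0
  then show ?case using assms by (auto intro: continuous_on_inverse)
next
  case (Suc n)
  obtain f' where f': "\<And>x. x \<in> A \<Longrightarrow> (f has_vector_derivative f' x) (at x)" "cont_diff n f' A"
    using Suc.prems by (auto elim: cont_diff_SucE)
  have IH: "cont_diff n (\<lambda>x. inverse (f x)) A"
    using Suc cont_diff_Suc_imp by blast
  have "((\<lambda>x. inverse (f x)) has_vector_derivative
      (- 1) * (inverse (f x) * f' x * inverse (f x))) (at x)" if "x \<in> A" for x
    using Deriv.has_derivative_inverse[OF assms[OF that] f'(1)[OF that, unfolded has_vector_derivative_def]]
    by (simp add: has_vector_derivative_def)
  moreover have "cont_diff n (\<lambda>x. (- 1) * (inverse (f x) * f' x * inverse (f x))) A"
    by (intro cont_diff_mult cont_diff_const IH f'(2))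
  ultimately show ?case
    by (rule cont_diff_SucI)
qed

lemma cont_diff_cis_linear: "cont_diff n (\<lambda>x. cis (w * x)) A"
proof (induction n)
  case 0
  show ?case by (auto intro!: continuous_intros)
next
  case (Suc n)
  show ?case
    by (rule cont_diff_SucI[OF has_vector_derivative_cis_linear
        cont_diff_mult[OF cont_diff_const Suc]])
qed

lemma cont_diff_shift:
  "cont_diff n f A \<Longrightarrow> cont_diff n (\<lambda>x. f (x - c)) {x. x - c \<in> A}"
proof (induction n arbitrary: f)
  case 0
  then have "continuous_on A f" by simp
  then have "continuous_on {x. x - c \<in> A} (\<lambda>x. f (x - c))"
    by (rule continuous_on_compose2) (auto intro!: continuous_on_diff continuous_on_const continuous_on_id)
  then show ?case by simp
next
  case (Suc n)
  obtain f' where f': "\<And>x. x \<in> A \<Longrightarrow> (f has_vector_derivative f' x) (at x)" "cont_diff n f' A"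
    using Suc.prems by (auto elim: cont_diff_SucE)
  have "((\<lambda>x. f (x - c)) has_vector_derivative f' (x - c)) (at x)" if "x - c \<in> A" for x
    using vector_diff_chain_at[of "\<lambda>x. x - c" 1 x f "f' (x - c)"] f'(1)[OF that]
      has_vector_derivative_diff_const[of "\<lambda>x. x" c 1 "at x"]
    by (simp add: o_def)
  then show ?case
    by (intro cont_diff_SucI[OF _ Suc.IH[OF f'(2)]]) simp
qed

text \<open>A witness \<open>f'\<close> is known to agree with \<open>deriv f\<close> only on
  \<open>A\<close>; since \<open>A\<close> is open, that agreement carries over to all further
  derivatives.\<close>

lemma cont_diff_imp_Ck_on:
  fixes f :: "real \<Rightarrow> real"
  assumes "open A"
  shows "cont_diff n f A \<Longrightarrow> Ck_on n f A"
proof (induction n arbitrary: f)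
  case 0
  then show ?case by (simp add: Ck_on_def)
next
  case (Suc n)
  obtain f' where *: "\<And>x. x \<in> A \<Longrightarrow> (f has_vector_derivative f' x) (at x)" "cont_diff n f' A"
    using Suc.prems by (auto elim: cont_diff_SucE)
  have eq: "f' x = deriv f x" if "x \<in> A" for x
    by (metis *(1) that DERIV_imp_deriv has_real_derivative_iff_has_vector_derivative)
  have "Ck_on n (deriv f) A"
    using Suc.IH cont_diff_cong[OF assms eq *(2)] by blast
  moreover have "f differentiable_on A"
    using *(1) differentiableI_vector differentiable_at_imp_differentiable_on by blast
  ultimately show ?case
    unfolding Ck_on_def
    by (auto simp: less_Suc_eq_0_disj funpow_Suc_right simp del: funpow.simps)
qed

lemma deriv_periodic:
  fixes f :: "real \<Rightarrow> real"
  assumes "\<And>x. f (x + c) = f x"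
  shows "deriv f (x + c) = deriv f x"
proof -
  have "DERIV f (x + c) :> D \<longleftrightarrow> DERIV f x :> D" for D
    unfolding DERIV_shift[of f D x c] assms ..
  then show ?thesis
    by (simp add: deriv_def)
qed

lemma Ck_per_cont_diffI:
  assumes "cont_diff n f UNIV" "\<And>x. f (x + 2 * pi) = f x"
  shows "f \<in> Ck_per n"
proof -
  have "(deriv ^^ i) f (x + 2 * pi) = (deriv ^^ i) f x" for i x
    using assms(2) by (induction i arbitrary: x) (auto intro: deriv_periodic)
  with assms(1) show ?thesis
    by (auto simp: Ck_per_def intro: cont_diff_imp_Ck_on)
qed

section \<open>Termwise differentiation of absolutely convergent trigonometric series\<close>

lemma suminf_tail_tendsto_0:
  fixes f :: "nat \<Rightarrow> real"
  assumes "summable f"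
  shows "(\<lambda>N. \<Sum>n. f (n + N)) \<longlonglongrightarrow> 0"
proof -
  have "(\<lambda>N. suminf f - sum f {..<N}) \<longlonglongrightarrow> suminf f - suminf f"
    by (intro tendsto_intros summable_LIMSEQ assms)
  then show ?thesis by (simp add: suminf_minus_initial_segment[OF assms])
qed

lemma norm_partial_sum_diff_le:
  fixes f :: "nat \<Rightarrow> 'a::banach"
  assumes "\<And>n. norm (f n) \<le> b n" "summable b"
  shows "norm (sum f {..<N} - suminf f) \<le> (\<Sum>n. b (n + N))"
proof -
  have f: "summable f" using assms summable_comparison_test' by blast
  have "norm (sum f {..<N} - suminf f) = norm (\<Sum>n. f (n + N))"
    by (simp add: suminf_minus_initial_segment[OF f] norm_minus_commute)
  also have "\<dots> \<le> (\<Sum>n. b (n + N))"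
    using assms by (intro norm_suminf_le) (auto simp: summable_iff_shift)
  finally show ?thesis .
qed

lemma has_vector_derivative_trig_series:
  fixes c :: "nat \<Rightarrow> complex" and w :: "nat \<Rightarrow> real"
  assumes "summable (\<lambda>n. norm (c n))" "summable (\<lambda>n. norm (\<i> * of_real (w n) * c n))"
  shows "((\<lambda>x. \<Sum>n. c n * cis (w n * x)) has_vector_derivative
          (\<Sum>n. \<i> * of_real (w n) * c n * cis (w n * x))) (at x)"
proof (rule has_vector_derivative_uniform_limit)
  show "((\<lambda>x. \<Sum>n<N. c n * cis (w n * x)) has_vector_derivative
          (\<Sum>n<N. \<i> * of_real (w n) * c n * cis (w n * x))) (at x)" for N x
  proof (rule has_vector_derivative_sum)
    fix n
    show "((\<lambda>x. c n * cis (w n * x)) has_vector_derivative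
            \<i> * of_real (w n) * c n * cis (w n * x)) (at x)"
      using has_vector_derivative_mult_right[OF has_vector_derivative_cis_linear, of "c n" "w n" x]
      by (simp only: mult_ac)
  qed
  show "norm ((\<Sum>n<N. \<i> * of_real (w n) * c n * cis (w n * x)) -
      (\<Sum>n. \<i> * of_real (w n) * c n * cis (w n * x)))
      \<le> (\<Sum>n. norm (\<i> * of_real (w (n + N)) * c (n + N)))" for N x
    by (rule norm_partial_sum_diff_le[where b = "\<lambda>n. norm (\<i> * of_real (w n) * c n)"])
       (use assms in \<open>auto simp: norm_mult\<close>)
  show "(\<lambda>N. \<Sum>n. norm (\<i> * of_real (w (n + N)) * c (n + N))) \<longlonglongrightarrow> 0"
    using suminf_tail_tendsto_0[OF assms(2)] .
  show "(\<lambda>N. \<Sum>n<N. c n * cis (w n * x)) \<longlonglongrightarrow> (\<Sum>n. c n * cis (w n * x))" for x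
    using assms(1) by (intro summable_LIMSEQ summable_norm_cancel[of "\<lambda>n. c n * cis (w n * x)"])
      (auto simp: norm_mult)
qed

lemma continuous_on_trig_series:
  fixes c :: "nat \<Rightarrow> complex" and w :: "nat \<Rightarrow> real"
  assumes "summable (\<lambda>n. norm (c n))"
  shows "continuous_on A (\<lambda>x. \<Sum>n. c n * cis (w n * x))"
proof (rule uniform_limit_theorem)
  show "uniform_limit A (\<lambda>N x. \<Sum>n<N. c n * cis (w n * x))
      (\<lambda>x. \<Sum>n. c n * cis (w n * x)) sequentially"
    using assms by (intro Weierstrass_m_test) (auto simp: norm_mult)
qed (auto intro!: always_eventually continuous_intros)

text \<open>Differentiation multiplies \<open>c n\<close> by \<open>\<i> * w n\<close>, so the
  summability condition for \<open>Suc i\<close> on the old coefficients is the one for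
  \<open>i\<close> on the new ones.\<close>

lemma cont_diff_trig_series:
  fixes c :: "nat \<Rightarrow> complex" and w :: "nat \<Rightarrow> real"
  assumes "\<And>i. i \<le> r \<Longrightarrow> summable (\<lambda>n. norm (c n) * \<bar>w n\<bar> ^ i)"
  shows "cont_diff r (\<lambda>x. \<Sum>n. c n * cis (w n * x)) A"
  using assms
proof (induction r arbitrary: c)
  case 0
  then show ?case
    using continuous_on_trig_series by simp
next
  case (Suc r)
  have D: "((\<lambda>x. \<Sum>n. c n * cis (w n * x)) has_vector_derivative
          (\<Sum>n. \<i> * of_real (w n) * c n * cis (w n * x))) (at x)" for x
    using Suc.prems[of 0] Suc.prems[of 1]
    by (intro has_vector_derivative_trig_series) (auto simp: norm_mult mult.commute)
  have "cont_diff r (\<lambda>x. \<Sum>n. (\<i> * of_real (w n) * c n) * cis (w n * x)) A"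
  proof (rule Suc.IH)
    fix i assume "i \<le> r"
    then show "summable (\<lambda>n. norm (\<i> * of_real (w n) * c n) * \<bar>w n\<bar> ^ i)"
      using Suc.prems[of "Suc i"] by (simp add: norm_mult mult_ac)
  qed
  then show ?case
    by (rule cont_diff_SucI[OF D])
qed

section \<open>Trigonometric polylogarithms\<close>

text \<open>This is C + i S wherever the series converges. Lowering the order by one is then
  differentiation up to the factor \<open>\<i>\<close>, for both families at once.\<close>

definition polylog_cis :: "nat \<Rightarrow> nat \<Rightarrow> nat \<Rightarrow> real \<Rightarrow> complex" where
  "polylog_cis k j r x = (\<Sum>n. cis (real (n * k + j) * x) / of_nat (n * k + j) ^ r)"

lemma summable_inverse_arith_power:
  assumes "k > 0" "j > 0" "r \<ge> 2"
  shows "summable (\<lambda>n. 1 / real (n * k + j) ^ r)"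
proof (rule summable_comparison_test')
  show "summable (\<lambda>n. inverse (real (Suc n) ^ r))"
    using summable_Suc_iff[of "\<lambda>n. inverse (real n ^ r)"] inverse_power_summable[OF assms(3), where ?'a = real] by simp
  fix n
  have "Suc n \<le> n * k + j" using assms by (cases k) auto
  then have "real (Suc n) ^ r \<le> real (n * k + j) ^ r"
    by (intro power_mono) (simp_all only: of_nat_le_iff of_nat_0_le_iff)
  then show "norm (1 / real (n * k + j) ^ r) \<le> inverse (real (Suc n) ^ r)"
    using le_imp_inverse_le[of "real (Suc n) ^ r"] by (simp add: divide_inverse del: of_nat_add of_nat_mult of_nat_Suc)
qed

lemma arith_progression_inverse_tendsto_0:
  assumes "k > 0"
  shows "(\<lambda>n. 1 / real (n * k + j)) \<longlonglongrightarrow> 0"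
proof (rule Lim_null_comparison[OF _ lim_inverse_n])
  have le: "norm (1 / real (n * k + j)) \<le> inverse (real n)" if "n > 0" for n
  proof -
    have "n \<le> n * k + j" using assms by (cases k) auto
    then have "real n \<le> real (n * k + j)"
      by (simp only: of_nat_le_iff)
    with that show ?thesis by (simp add: divide_simps)
  qed
  show "\<forall>\<^sub>F n in sequentially. norm (1 / real (n * k + j)) \<le> inverse (real n)"
    by (rule eventually_mono[OF eventually_gt_at_top[of 0] le])
qed

lemma polylog_cis_sums:
  assumes "k > 0" "j > 0" "r \<ge> 2"
  shows "(\<lambda>n. cis (real (n * k + j) * x) / of_nat (n * k + j) ^ r) sums polylog_cis k j r x"
  unfolding polylog_cis_def
  using summable_inverse_arith_power[OF assms]
  by (intro summable_sums summable_norm_cancel[of "\<lambda>n. _ n / _ n"])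
     (simp add: norm_divide norm_power flip: of_nat_mult of_nat_add)

text \<open>Summation by parts: multiplied by \<open>1 - cis (k x)\<close>, the conditionally convergent series
  has the summable coefficients \<open>1/j\<close> and \<open>1/w(n+1) - 1/w(n)\<close>, where \<open>w(n) = n k + j\<close>.\<close>

lemma one_minus_cis_times_partial_sum:
  fixes a :: "nat \<Rightarrow> complex"
  shows "(1 - cis (real k * x)) * (\<Sum>n<N. a n * cis (real (n * k + j) * x)) =
    a 0 * cis (real j * x) + (\<Sum>n<N. (a (Suc n) - a n) * cis (real (Suc n * k + j) * x))
    - a N * cis (real (N * k + j) * x)"
proof (induction N)
  case (Suc N)
  have "cis (real k * x) * cis (real (N * k + j) * x) = cis (real (Suc N * k + j) * x)"
    by (simp add: cis_mult algebra_simps)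
  with Suc show ?case
    by (simp only: sum.lessThan_Suc ring_distribs left_diff_distrib right_diff_distrib)
       (simp add: algebra_simps)
qed simp

text \<open>The product of \<open>1 - cis (k x)\<close> and the order-1 polylogarithm, as obtained
  by summation by parts. Its series converges absolutely for every \<open>x\<close>, nodes
  included.\<close>

definition polylog_regular :: "nat \<Rightarrow> nat \<Rightarrow> real \<Rightarrow> complex" where
  "polylog_regular k j x = 1 / of_nat j * cis (real j * x) +
     (\<Sum>n. (1 / of_nat (Suc n * k + j) - 1 / of_nat (n * k + j)) * cis (real (Suc n * k + j) * x))"

text \<open>The reciprocal frequencies decrease, so the tail of their differences telescopes to
  \<open>1 / (N k + j)\<close>; the boundary term has the same norm. Together they give the 2,
  uniformly in \<open>x\<close>.\<close>

lemma norm_diff_polylog_regular_le: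
  assumes "k > 0" "j > 0"
  shows "norm ((1 - cis (real k * x)) * (\<Sum>n<N. 1 / of_nat (n * k + j) * cis (real (n * k + j) * x))
           - polylog_regular k j x) \<le> 2 / real (N * k + j)"
proof -
  let ?a = "\<lambda>n. 1 / real (n * k + j)"
  let ?f = "\<lambda>n. (1 / of_nat (Suc n * k + j) - 1 / of_nat (n * k + j)) * cis (real (Suc n * k + j) * x)"
  have mono: "?a (Suc n) \<le> ?a n" for n
    using assms by (intro divide_left_mono) (auto intro!: mult_pos_pos add_nonneg_pos)
  have "norm (?f n) = \<bar>?a (Suc n) - ?a n\<bar>" for n
  proof -
    have "(1 / of_nat (Suc n * k + j) - 1 / of_nat (n * k + j) :: complex) = of_real (?a (Suc n) - ?a n)"
      by simp
    then show ?thesis by (simp only: norm_mult norm_of_real norm_cis mult_1_right)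
  qed
  then have f: "norm (?f n) \<le> ?a n - ?a (Suc n)" for n
    using mono[of n] by simp
  have tail: "norm (sum ?f {..<N} - suminf ?f) \<le> (\<Sum>n. ?a (n + N) - ?a (Suc (n + N)))"
    using norm_partial_sum_diff_le[of ?f "\<lambda>n. ?a n - ?a (Suc n)" N, OF f]
      telescope_summable'[OF arith_progression_inverse_tendsto_0[OF assms(1)]] by simp
  have "(\<lambda>n. ?a (n + N)) \<longlonglongrightarrow> 0"
    by (rule LIMSEQ_ignore_initial_segment[OF arith_progression_inverse_tendsto_0[OF assms(1)]])
  from telescope_sums'[OF this] have "(\<Sum>n. ?a (n + N) - ?a (Suc (n + N))) = ?a N"
    by (simp add: sums_iff)
  with tail have tail': "norm (sum ?f {..<N} - suminf ?f) \<le> ?a N"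
    by simp
  have eq: "(1 - cis (real k * x)) * (\<Sum>n<N. 1 / of_nat (n * k + j) * cis (real (n * k + j) * x))
           - polylog_regular k j x
      = (sum ?f {..<N} - suminf ?f) - 1 / of_nat (N * k + j) * cis (real (N * k + j) * x)"
    unfolding one_minus_cis_times_partial_sum polylog_regular_def by simp
  have "norm ((1 - cis (real k * x)) * (\<Sum>n<N. 1 / of_nat (n * k + j) * cis (real (n * k + j) * x))
           - polylog_regular k j x) \<le> norm (sum ?f {..<N} - suminf ?f) + norm (1 / of_nat (N * k + j) * cis (real (N * k + j) * x))"
    unfolding eq by (rule norm_triangle_ineq4)
  also have "norm (1 / of_nat (N * k + j) * cis (real (N * k + j) * x)) = ?a N"
    by (simp add: norm_mult norm_divide del: of_nat_mult of_nat_add)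
  finally show ?thesis using tail' by simp
qed

lemma polylog_regular_LIMSEQ:
  assumes "k > 0" "j > 0"
  shows "(\<lambda>N. (1 - cis (real k * x)) * (\<Sum>n<N. 1 / of_nat (n * k + j) * cis (real (n * k + j) * x)))
    \<longlonglongrightarrow> polylog_regular k j x"
proof (rule Lim_transform[OF tendsto_const])
  show "(\<lambda>N. (1 - cis (real k * x)) * (\<Sum>n<N. 1 / of_nat (n * k + j) * cis (real (n * k + j) * x))
      - polylog_regular k j x) \<longlonglongrightarrow> 0"
  proof (rule Lim_null_comparison)
    show "(\<lambda>N. 2 / real (N * k + j)) \<longlonglongrightarrow> 0"
      using tendsto_mult_right_zero[OF arith_progression_inverse_tendsto_0[OF assms(1)], of 2] by simp
    show "\<forall>\<^sub>F N in sequentially. norm ((1 - cis (real k * x)) * (\<Sum>n<N. 1 / of_nat (n * k + j) * cis (real (n * k + j) * x))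
      - polylog_regular k j x) \<le> 2 / real (N * k + j)"
      using norm_diff_polylog_regular_le[OF assms]
      by (intro always_eventually allI)
  qed
qed

lemma polylog_cis_1_sums_regular:
  assumes "k > 0" "j > 0" "cis (real k * x) \<noteq> 1"
  shows "(\<lambda>n. cis (real (n * k + j) * x) / of_nat (n * k + j) ^ 1) sums
           (polylog_regular k j x / (1 - cis (real k * x)))"
proof -
  have "(\<lambda>N. (1 - cis (real k * x)) * (\<Sum>n<N. 1 / of_nat (n * k + j) * cis (real (n * k + j) * x))
      / (1 - cis (real k * x))) \<longlonglongrightarrow> polylog_regular k j x / (1 - cis (real k * x))"
    using assms by (intro tendsto_divide polylog_regular_LIMSEQ) auto
  then show ?thesis
    using assms(3) by (simp add: sums_def)
qed

lemma polylog_cis_1_eq: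
  assumes "k > 0" "j > 0" "cis (real k * x) \<noteq> 1"
  shows "polylog_cis k j 1 x = polylog_regular k j x / (1 - cis (real k * x))"
  unfolding polylog_cis_def using polylog_cis_1_sums_regular[OF assms] by (simp only: sums_iff)

lemma polylog_cis_1_sums:
  assumes "k > 0" "j > 0" "cis (real k * x) \<noteq> 1"
  shows "(\<lambda>n. cis (real (n * k + j) * x) / of_nat (n * k + j) ^ 1) sums polylog_cis k j 1 x"
  unfolding polylog_cis_1_eq[OF assms] by (rule polylog_cis_1_sums_regular[OF assms])

lemma open_not_nodes: "open {x. cis (real k * x) \<noteq> 1}"
  by (rule open_Collect_neq) (auto intro!: continuous_intros)

text \<open>Differentiating \<open>(1 - cis (k x))\<^sup>2\<close> times the partial sums produces a non-convergent boundary
  term, which the additional summand of size \<open>O(1/N)\<close> below cancels.\<close>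

lemma has_vector_derivative_polylog_regular:
  assumes "k > 0" "j > 0"
  shows "((\<lambda>x. (1 - cis (real k * x)) * polylog_regular k j x) has_vector_derivative
    (\<i> * (1 - cis (real k * x)) * cis (real j * x)
      - 2 * \<i> * of_nat k * cis (real k * x) * polylog_regular k j x)) (at x)"
proof -
  define z where "z = (\<lambda>x. cis (real k * x))"
  define e where "e = (\<lambda>n x. cis (real (n * k + j) * x))"
  define b where "b = (\<lambda>n. 1 / of_nat (n * k + j) :: complex)"
  define F where "F = (\<lambda>N x. \<Sum>n<N. b n * e n x)"
  let ?g = "\<lambda>x. \<i> * (1 - z x) * e 0 x - 2 * \<i> * of_nat k * z x * polylog_regular k j x"
  let ?f' = "\<lambda>N x. \<i> * (1 - z x) * e 0 x - 2 * \<i> * of_nat k * z x * ((1 - z x) * F N x)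
               - \<i> * of_nat k * z x * b N * e N x"
  have b: "of_nat (n * k + j) * b n = 1" for n
    using assms by (simp add: b_def del: of_nat_mult of_nat_add)
  have dz: "(z has_vector_derivative \<i> * of_nat k * z x) (at x)" for x
    unfolding z_def using has_vector_derivative_cis_linear[of "real k" x] by simp
  have de: "(e n has_vector_derivative \<i> * of_nat (n * k + j) * e n x) (at x)" for n x
    unfolding e_def using has_vector_derivative_cis_linear[of "real (n * k + j)" x]
    by (simp only: of_real_of_nat_eq)
  \<comment> \<open>Summation by parts with constant coefficients is the finite geometric sum. The
    term \<open>e N x\<close> has modulus 1 and is the boundary term that \<open>b N * e N x\<close>
    cancels in \<open>d2\<close>.\<close>
  have telescope: "(1 - z x) * (\<Sum>n<N. e n x) = e 0 x - e N x" for N x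
    using one_minus_cis_times_partial_sum[of k x "\<lambda>_. 1" j N] by (simp add: e_def z_def)
  have dF: "(F N has_vector_derivative \<i> * (\<Sum>n<N. e n x)) (at x)" for N x
  proof -
    have "((\<lambda>x. b n * e n x) has_vector_derivative \<i> * e n x) (at x)" for n
    proof -
      have "b n * (\<i> * of_nat (n * k + j) * e n x) = (of_nat (n * k + j) * b n) * (\<i> * e n x)"
        by (simp only: mult_ac)
      then show ?thesis
        using has_vector_derivative_mult_right[OF de[of n x], of "b n"]
        by (simp only: b mult_1_left)
    qed
    then show ?thesis
      unfolding F_def sum_distrib_left by (intro has_vector_derivative_sum)
  qed
  have d1: "((\<lambda>x. 1 - z x) has_vector_derivative - (\<i> * of_nat k * z x)) (at x)" for x
    using has_vector_derivative_diff[OF has_vector_derivative_const[of 1] dz[of x]] by simp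
  have d2: "((\<lambda>x. (1 - z x) * F N x + b N * e N x) has_vector_derivative
       - (\<i> * of_nat k * z x) * F N x + \<i> * e 0 x) (at x)" for N x
  proof -
    have *: "(1 - z x) * (\<i> * (\<Sum>n<N. e n x)) = \<i> * (e 0 x - e N x)"
      using telescope[of x N] by (simp add: mult.left_commute)
    have **: "b N * (\<i> * of_nat (N * k + j) * e N x) = \<i> * e N x"
      using b[of N] by (metis mult.assoc mult.commute mult.right_neutral)
    show ?thesis
      using has_vector_derivative_add[OF has_vector_derivative_mult[OF d1[of x] dF[of N x]]
        has_vector_derivative_mult_right[OF de[of N x], of "b N"]]
      unfolding * ** by (simp add: algebra_simps)
  qed
  \<comment> \<open>The derivative in \<open>d2\<close> still contains \<open>F N\<close> without a
    factor \<open>1 - z\<close>, which does not converge at the nodes. The second factor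
    \<open>1 - z\<close> turns it into \<open>(1 - z) * F N\<close>, whose convergence is
    uniform.\<close>
  have "((\<lambda>x. (1 - z x) * polylog_regular k j x) has_vector_derivative ?g x) (at x)"
  proof (rule has_vector_derivative_uniform_limit)
    show "((\<lambda>x. (1 - z x) * ((1 - z x) * F N x + b N * e N x)) has_vector_derivative ?f' N x) (at x)"
      for N x
      using has_vector_derivative_mult[OF d1[of x] d2[of N x]]
      by (simp add: algebra_simps)
    \<comment> \<open>The 5 is 2 * 2 + 1: twice \<open>real k\<close> times the bound with numerator
      2, and once \<open>real k\<close> for the term with \<open>b N * e N\<close>.\<close>
    show "norm (?f' N x - ?g x) \<le> 5 * real k * (1 / real (N * k + j))" for N x
    proof -
      have eq: "?f' N x - ?g x = - (2 * \<i> * of_nat k * z x) * ((1 - z x) * F N x - polylog_regular k j x)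
           - \<i> * of_nat k * z x * b N * e N x"
        by (simp add: algebra_simps)
      have "norm (?f' N x - ?g x) \<le> norm (- (2 * \<i> * of_nat k * z x) * ((1 - z x) * F N x - polylog_regular k j x))
          + norm (\<i> * of_nat k * z x * b N * e N x)"
        unfolding eq by (rule norm_triangle_ineq4)
      also have "\<dots> = 2 * real k * norm ((1 - z x) * F N x - polylog_regular k j x) + real k * (1 / real (N * k + j))"
        by (simp add: norm_mult norm_divide z_def e_def b_def del: of_nat_mult of_nat_add)
      also have "\<dots> \<le> 2 * real k * (2 / real (N * k + j)) + real k * (1 / real (N * k + j))"
        using norm_diff_polylog_regular_le[OF assms, of x N]
        by (intro add_right_mono mult_left_mono) (simp_all add: z_def F_def b_def e_def)
      finally show ?thesis by simp
    qed
    show "(\<lambda>N. 5 * real k * (1 / real (N * k + j))) \<longlonglongrightarrow> 0"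
      by (intro tendsto_mult_right_zero arith_progression_inverse_tendsto_0 assms)
    show "(\<lambda>N. (1 - z x) * ((1 - z x) * F N x + b N * e N x)) \<longlonglongrightarrow> (1 - z x) * polylog_regular k j x" for x
    proof -
      have "(\<lambda>N. b N * e N x) \<longlonglongrightarrow> 0"
        by (rule tendsto_norm_zero_cancel)
           (use arith_progression_inverse_tendsto_0[OF assms(1), of j] in
             \<open>simp add: norm_mult norm_divide b_def e_def del: of_nat_mult of_nat_add\<close>)
      moreover have "(\<lambda>N. (1 - z x) * F N x) \<longlonglongrightarrow> polylog_regular k j x"
        using polylog_regular_LIMSEQ[OF assms] by (simp add: z_def F_def b_def e_def)
      ultimately have "(\<lambda>N. (1 - z x) * F N x + b N * e N x) \<longlonglongrightarrow> polylog_regular k j x + 0"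
        by (intro tendsto_add)
      then show ?thesis
        by (intro tendsto_mult tendsto_const) simp
    qed
  qed
  then show ?thesis
    by (simp add: z_def e_def)
qed

text \<open>Formally this sums the geometric series obtained by termwise differentiation.
  Rigorously, \<open>(1 - z) * G\<close> is divided by the square of \<open>1 - z\<close>; the
  quotient rule cancels every occurrence of \<open>G\<close>.\<close>

lemma has_vector_derivative_polylog_cis_1:
  assumes "k > 0" "j > 0" "cis (real k * x) \<noteq> 1"
  shows "(polylog_cis k j 1 has_vector_derivative
           \<i> * cis (real j * x) * inverse (1 - cis (real k * x))) (at x)"
proof -
  define z where "z = (\<lambda>x. cis (real k * x))"
  define G where "G = polylog_regular k j"
  define g where "g = \<i> * (1 - z x) * cis (real j * x) - 2 * \<i> * of_nat k * z x * G x"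
  have z: "1 - z x \<noteq> 0" using assms by (simp add: z_def)
  have dz: "((\<lambda>x. 1 - z x) has_vector_derivative - (\<i> * of_nat k * z x)) (at x)"
    using has_vector_derivative_diff[OF has_vector_derivative_const[of 1]
        has_vector_derivative_cis_linear[of "real k" x]] by (simp add: z_def)
  define h where "h = - (inverse (1 - z x) * (- (\<i> * of_nat k * z x)) * inverse (1 - z x))"
  have di: "((\<lambda>x. inverse (1 - z x)) has_vector_derivative h) (at x)"
    using Deriv.has_derivative_inverse[OF z dz[unfolded has_vector_derivative_def]]
    by (simp add: has_vector_derivative_def h_def)
  have dG: "((\<lambda>x. (1 - z x) * G x) has_vector_derivative g) (at x)"
    using has_vector_derivative_polylog_regular[OF assms(1,2), of x] by (simp add: z_def G_def g_def)
  let ?D = "((1 - z x) * G x) * (inverse (1 - z x) * h + h * inverse (1 - z x))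
         + g * (inverse (1 - z x) * inverse (1 - z x))"
  have "((\<lambda>x. ((1 - z x) * G x) * (inverse (1 - z x) * inverse (1 - z x))) has_vector_derivative ?D) (at x)"
    by (intro has_vector_derivative_mult dG di)
  moreover have "?D = \<i> * cis (real j * x) * inverse (1 - cis (real k * x))"
  proof -
    \<comment> \<open>With \<open>v\<close> a free variable subject to
      \<open>(1 - Z) * v = 1\<close>, the quotient rule becomes a division-free polynomial
      identity.\<close>
    have "((1 - Z) * g0) * (v * h0 + h0 * v) + (c * (1 - Z) * E - 2 * c * K * Z * g0) * (v * v) = c * E * v"
      if "(1 - Z) * v = 1" "h0 = v * (c * K * Z) * v" for Z v g0 h0 c K E :: complex
      using that by algebra
    from this[of "z x" "inverse (1 - z x)" h \<i> "of_nat k" "G x" "cis (real j * x)"] show ?thesis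
      unfolding g_def using z by (simp add: h_def z_def)
  qed
  moreover have "((1 - z y) * G y) * (inverse (1 - z y) * inverse (1 - z y)) = polylog_cis k j 1 y"
    if "y \<in> {y. cis (real k * y) \<noteq> 1}" for y
  proof -
    have "((1 - z y) * G y) * (inverse (1 - z y) * inverse (1 - z y)) = G y / (1 - z y)"
      using that by (simp add: z_def divide_simps)
    then show ?thesis
      using that polylog_cis_1_eq[OF assms(1,2), of y] by (simp add: z_def G_def)
  qed
  ultimately show ?thesis
    using has_vector_derivative_transform_within_open[OF _ open_not_nodes[of k], of _ _ x] assms(3)
    by fastforce
qed

text \<open>The differentiated series converges only conditionally, so the theorem for absolutely
  convergent series does not apply. One factor \<open>1 - z\<close> suffices here: its own
  derivative meets \<open>F2 N\<close>, which already converges uniformly.\<close>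

lemma has_vector_derivative_polylog_cis_2:
  assumes "k > 0" "j > 0" "cis (real k * x) \<noteq> 1"
  shows "(polylog_cis k j 2 has_vector_derivative \<i> * polylog_cis k j 1 x) (at x)"
proof -
  define z where "z = (\<lambda>x. cis (real k * x))"
  define e where "e = (\<lambda>n x. cis (real (n * k + j) * x))"
  define b where "b = (\<lambda>n. 1 / of_nat (n * k + j) :: complex)"
  define F where "F = (\<lambda>N x. \<Sum>n<N. b n * e n x)"
  define F2 where "F2 = (\<lambda>N x. \<Sum>n<N. b n ^ 2 * e n x)"
  let ?P = "polylog_cis k j 2" and ?G = "polylog_regular k j"
  \<comment> \<open>The first summand controls \<open>F2 N\<close>, weighted by the derivative of
    \<open>1 - z\<close> of norm \<open>real k\<close>; the second controls
    \<open>(1 - z) * F N\<close>.\<close>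
  define \<epsilon> where "\<epsilon> = (\<lambda>N. real k * (\<Sum>n. 1 / real ((n + N) * k + j) ^ 2) + 2 * (1 / real (N * k + j)))"
  have b: "of_nat (n * k + j) * b n = 1" for n
    using assms by (simp add: b_def del: of_nat_mult of_nat_add)
  have P: "?P x = (\<Sum>n. b n ^ 2 * e n x)" for x
    by (simp add: polylog_cis_def b_def e_def power_divide)
  have dz: "((\<lambda>x. 1 - z x) has_vector_derivative - (\<i> * of_nat k * z x)) (at x)" for x
    using has_vector_derivative_diff[OF has_vector_derivative_const[of 1]
        has_vector_derivative_cis_linear[of "real k" x]] by (simp add: z_def)
  have de: "(e n has_vector_derivative \<i> * of_nat (n * k + j) * e n x) (at x)" for n x
    unfolding e_def using has_vector_derivative_cis_linear[of "real (n * k + j)" x]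
    by (simp only: of_real_of_nat_eq)
  have dF2: "(F2 N has_vector_derivative \<i> * F N x) (at x)" for N x
  proof -
    have "((\<lambda>x. b n ^ 2 * e n x) has_vector_derivative \<i> * (b n * e n x)) (at x)" for n
    proof -
      have "b n ^ 2 * (\<i> * of_nat (n * k + j) * e n x) = (of_nat (n * k + j) * b n) * (\<i> * (b n * e n x))"
        by (simp only: mult_ac power2_eq_square)
      then show ?thesis
        using has_vector_derivative_mult_right[OF de[of n x], of "b n ^ 2"]
        by (simp only: b mult_1_left)
    qed
    then show ?thesis
      unfolding F2_def F_def sum_distrib_left by (intro has_vector_derivative_sum)
  qed
  have sum2: "summable (\<lambda>n. 1 / real (n * k + j) ^ 2)"
    using assms by (intro summable_inverse_arith_power) auto
  have F2_le: "norm (F2 N x - ?P x) \<le> (\<Sum>n. 1 / real ((n + N) * k + j) ^ 2)" for N x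
    unfolding F2_def P
    by (rule norm_partial_sum_diff_le[OF _ sum2])
       (simp add: norm_mult norm_power norm_divide b_def e_def power_divide del: of_nat_mult of_nat_add)
  let ?f' = "\<lambda>N x. (1 - z x) * (\<i> * F N x) + (- (\<i> * of_nat k * z x)) * F2 N x"
  let ?g = "\<lambda>x. \<i> * ?G x + (- (\<i> * of_nat k * z x)) * ?P x"
  have dP: "((\<lambda>x. (1 - z x) * ?P x) has_vector_derivative ?g x) (at x)"
  proof (rule has_vector_derivative_uniform_limit)
    show "((\<lambda>x. (1 - z x) * F2 N x) has_vector_derivative ?f' N x) (at x)" for N x
      by (rule has_vector_derivative_mult[OF dz dF2])
    show "norm (?f' N x - ?g x) \<le> \<epsilon> N" for N x
    proof -
      have eq: "?f' N x - ?g x = (- (\<i> * of_nat k * z x)) * (F2 N x - ?P x) + \<i> * ((1 - z x) * F N x - ?G x)"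
        by (simp add: algebra_simps)
      have "norm (?f' N x - ?g x) \<le> norm ((- (\<i> * of_nat k * z x)) * (F2 N x - ?P x)) + norm (\<i> * ((1 - z x) * F N x - ?G x))"
        unfolding eq by (rule norm_triangle_ineq)
      also have "\<dots> = real k * norm (F2 N x - ?P x) + norm ((1 - z x) * F N x - ?G x)"
        by (simp add: norm_mult z_def)
      also have "\<dots> \<le> \<epsilon> N"
        using norm_diff_polylog_regular_le[OF assms(1,2), of x N] F2_le[of N x] unfolding \<epsilon>_def
        by (intro add_mono mult_left_mono) (simp_all add: z_def F_def b_def e_def)
      finally show ?thesis .
    qed
    have "\<epsilon> \<longlonglongrightarrow> real k * 0 + 2 * 0"
      unfolding \<epsilon>_def
      by (intro tendsto_add tendsto_mult tendsto_const suminf_tail_tendsto_0[OF sum2]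
          arith_progression_inverse_tendsto_0 assms)
    then show "\<epsilon> \<longlonglongrightarrow> 0" by simp
    show "(\<lambda>N. (1 - z x) * F2 N x) \<longlonglongrightarrow> (1 - z x) * ?P x" for x
      using polylog_cis_sums[OF assms(1,2), of 2 x]
      by (intro tendsto_mult tendsto_const)
         (simp add: sums_def F2_def b_def e_def power_divide)
  qed
  have z: "1 - z x \<noteq> 0" using assms by (simp add: z_def)
  define h where "h = - (inverse (1 - z x) * (- (\<i> * of_nat k * z x)) * inverse (1 - z x))"
  have di: "((\<lambda>x. inverse (1 - z x)) has_vector_derivative h) (at x)"
    using Deriv.has_derivative_inverse[OF z dz[of x, unfolded has_vector_derivative_def]]
    by (simp add: has_vector_derivative_def h_def)
  let ?D = "((1 - z x) * ?P x) * h + ?g x * inverse (1 - z x)"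
  have "((\<lambda>x. ((1 - z x) * ?P x) * inverse (1 - z x)) has_vector_derivative ?D) (at x)"
    by (rule has_vector_derivative_mult[OF dP di])
  moreover have "?D = \<i> * polylog_cis k j 1 x"
  proof -
    have "polylog_cis k j 1 x = ?G x * inverse (1 - z x)"
      using polylog_cis_1_eq[OF assms] by (simp add: z_def divide_inverse)
    moreover have "((1 - Z) * P) * h0 + (c * g0 + (- (c * K * Z)) * P) * v = c * (g0 * v)"
      if "(1 - Z) * v = 1" "h0 = v * (c * K * Z) * v" for Z v g0 h0 c K P :: complex
      using that by algebra
    from this[of "z x" "inverse (1 - z x)" h \<i> "of_nat k" "?P x" "?G x"]
    have "?D = \<i> * (?G x * inverse (1 - z x))"
      using z by (simp add: h_def)
    ultimately show ?thesis by simp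
  qed
  moreover have "((1 - z y) * ?P y) * inverse (1 - z y) = ?P y"
    if "y \<in> {y. cis (real k * y) \<noteq> 1}" for y
    using that by (simp add: z_def)
  ultimately show ?thesis
    using has_vector_derivative_transform_within_open[OF _ open_not_nodes[of k], of _ _ x] assms(3)
    by fastforce
qed

text \<open>The differentiated coefficients are of size \<open>1 / w^2\<close>, hence absolutely
  summable, and the formula holds at the nodes as well.\<close>

lemma has_vector_derivative_polylog_cis_3:
  assumes "k > 0" "j > 0"
  shows "(polylog_cis k j 3 has_vector_derivative \<i> * polylog_cis k j 2 x) (at x)"
proof -
  let ?w = "\<lambda>n. real (n * k + j)"
  let ?c = "\<lambda>n. 1 / of_nat (n * k + j) ^ 3 :: complex"
  have w: "of_nat (n * k + j) \<noteq> (0 :: complex)" for n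
    using assms by (simp del: of_nat_mult of_nat_add)
  have c: "\<i> * of_real (?w n) * ?c n = \<i> * (1 / of_nat (n * k + j) ^ 2)" for n
    using w[of n] by (simp add: power2_eq_square power3_eq_cube del: of_nat_mult of_nat_add)
  have "((\<lambda>x. \<Sum>n. ?c n * cis (?w n * x)) has_vector_derivative
          (\<Sum>n. \<i> * of_real (?w n) * ?c n * cis (?w n * x))) (at x)"
  proof (rule has_vector_derivative_trig_series)
    show "summable (\<lambda>n. norm (?c n))"
      using summable_inverse_arith_power[OF assms, of 3]
      by (simp add: norm_divide norm_power del: of_nat_mult of_nat_add)
    show "summable (\<lambda>n. norm (\<i> * of_real (?w n) * ?c n))"
      unfolding c using summable_inverse_arith_power[OF assms, of 2]
      by (simp add: norm_mult norm_divide norm_power del: of_nat_mult of_nat_add)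
  qed
  moreover have "(\<lambda>x. \<Sum>n. ?c n * cis (?w n * x)) = polylog_cis k j 3"
    by (simp add: polylog_cis_def fun_eq_iff)
  moreover have "(\<Sum>n. \<i> * of_real (?w n) * ?c n * cis (?w n * x)) = \<i> * polylog_cis k j 2 x"
    unfolding c using suminf_mult[OF sums_summable[OF polylog_cis_sums[OF assms, of 2 x]], of \<i>]
    by (simp add: polylog_cis_def)
  ultimately show ?thesis by simp
qed

lemma cont_diff_polylog_cis_1:
  assumes "k > 0" "j > 0"
  shows "cont_diff n (polylog_cis k j 1) {x. cis (real k * x) \<noteq> 1}"
proof -
  have "cont_diff n (\<lambda>x. 1 + (- 1) * cis (real k * x)) A" for n A
    by (intro cont_diff_add cont_diff_mult cont_diff_const cont_diff_cis_linear)
  then have "cont_diff n (\<lambda>x. inverse (1 - cis (real k * x))) {x. cis (real k * x) \<noteq> 1}" for n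
    by (intro cont_diff_inverse) auto
  then have "cont_diff n (\<lambda>x. \<i> * cis (real j * x) * inverse (1 - cis (real k * x)))
      {x. cis (real k * x) \<noteq> 1}"
    by (intro cont_diff_mult cont_diff_const cont_diff_cis_linear)
  then show ?thesis
    \<comment> \<open>Order \<open>Suc n\<close> is proved and then lowered, because the derivative
      rule yields successor orders only.\<close>
    by (intro cont_diff_Suc_imp[OF cont_diff_SucI[OF has_vector_derivative_polylog_cis_1[OF assms]]])
       auto
qed

lemma cont_diff_polylog_cis_3:
  assumes "k > 0" "j > 0"
  shows "cont_diff n (polylog_cis k j 3) {x. cis (real k * x) \<noteq> 1}"
proof -
  let ?A = "{x. cis (real k * x) \<noteq> 1}"
  have "cont_diff n (polylog_cis k j 2) ?A"
    by (intro cont_diff_Suc_imp[OF cont_diff_SucI[OF has_vector_derivative_polylog_cis_2[OF assms]]]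
        cont_diff_mult cont_diff_const cont_diff_polylog_cis_1[OF assms]) auto
  then show ?thesis
    by (intro cont_diff_Suc_imp[OF cont_diff_SucI[OF has_vector_derivative_polylog_cis_3[OF assms]]]
        cont_diff_mult cont_diff_const)
qed

section \<open>Almost everywhere equality from convergence in mean square\<close>

lemma AE_lebesgue_periodic:
  fixes P :: "real \<Rightarrow> bool"
  assumes AE: "AE x in lebesgue. x \<in> {-pi<..<pi} \<longrightarrow> P x"
    and per: "\<And>x. P (x + 2 * pi) = P x"
  shows "AE x in lebesgue. P x"
proof -
  define B where "B = {x. \<not> (x \<in> {-pi<..<pi} \<longrightarrow> P x)}"
  have "negligible B"
    using AE unfolding B_def completion.AE_iff_null_sets negligible_iff_null_sets by simp
  \<comment> \<open>The open interval leaves out the endpoint; adjoining \<open>-pi\<close> lets the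
    translates cover every exceptional point of the line.\<close>
  then have neg: "negligible (\<Union>k::int. (+) (2 * pi * real_of_int k) ` (B \<union> {-pi}))"
    by (intro negligible_countable_Union) (auto intro!: negligible_translation)
  have per_int: "P (x + 2 * pi * real_of_int k) = P x" for x k
  proof (induction k rule: int_induct[where k = 0])
    case (step1 i)
    then show ?case using per[of "x + 2 * pi * real_of_int i"] by (simp add: algebra_simps)
  next
    case (step2 i)
    then show ?case using per[of "x + 2 * pi * real_of_int (i - 1)"] by (simp add: algebra_simps)
  qed simp
  have "{x. \<not> P x} \<subseteq> (\<Union>k::int. (+) (2 * pi * real_of_int k) ` (B \<union> {-pi}))"
  proof
    fix x assume "x \<in> {x. \<not> P x}"
    define k where "k = \<lfloor>(x + pi) / (2 * pi)\<rfloor>"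
    define y where "y = x - 2 * pi * real_of_int k"
    have "real_of_int k \<le> (x + pi) / (2 * pi)" "(x + pi) / (2 * pi) < real_of_int k + 1"
      unfolding k_def by linarith+
    then have "- pi \<le> y" "y < pi"
      by (simp_all add: y_def field_simps)
    moreover have "\<not> P y"
      using \<open>x \<in> _\<close> per_int[of y k] by (simp add: y_def)
    ultimately have "y \<in> B \<union> {-pi}"
      by (auto simp: B_def)
    then show "x \<in> (\<Union>k::int. (+) (2 * pi * real_of_int k) ` (B \<union> {-pi}))"
      by (intro UN_I[of k] image_eqI[of _ _ y]) (auto simp: y_def)
  qed
  then show ?thesis
    using negligible_subset[OF neg] by (simp add: completion.AE_iff_null_sets negligible_iff_null_sets)
qed

text \<open>Convergence in mean square is L1 convergence of the squared differences, so these tend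
  to 0 almost everywhere along a subsequence, while the same subsequence of \<open>g\<close> tends
  to \<open>h\<close>.\<close>

lemma AE_eq_of_L2_limit:
  fixes f h :: "real \<Rightarrow> real" and g :: "nat \<Rightarrow> real \<Rightarrow> real"
  assumes f: "f \<in> borel_measurable lebesgue" "set_integrable lebesgue {a<..<b} (\<lambda>x. (f x)\<^sup>2)"
    and g: "\<And>N. continuous_on UNIV (g N)" "\<And>N x. \<bar>g N x\<bar> \<le> B N"
    and L2: "(\<lambda>N. LINT x:{a<..<b}|lebesgue. (f x - g N x)\<^sup>2) \<longlonglongrightarrow> 0"
    and lim: "AE x in lebesgue. (\<lambda>N. g N x) \<longlonglongrightarrow> h x"
  shows "AE x in lebesgue. x \<in> {a<..<b} \<longrightarrow> f x = h x"
proof -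
  let ?I = "indicator {a<..<b} :: real \<Rightarrow> real"
  let ?d = "\<lambda>N x. ?I x *\<^sub>R (f x - g N x)\<^sup>2"
  have gm: "g N \<in> borel_measurable lebesgue" for N
    using borel_measurable_continuous_onI[OF g(1)] by (intro measurable_completion) simp
  have Im: "?I \<in> borel_measurable lebesgue"
    by (intro borel_measurable_indicator) simp
  \<comment> \<open>The integral of a non-integrable function is 0 by default, so \<open>L2\<close>
    alone would say nothing without this.\<close>
  have int: "integrable lebesgue (?d N)" for N
  proof (rule Bochner_Integration.integrable_bound)
    have "integrable lebesgue ?I"
      by (cases "a \<le> b") (auto simp: integrable_indicator_iff)
    then show "integrable lebesgue (\<lambda>x. 2 * (?I x *\<^sub>R (f x)\<^sup>2) + 2 * (B N)\<^sup>2 * ?I x)"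
      using f(2) unfolding set_integrable_def by auto
    show "?d N \<in> borel_measurable lebesgue"
      using f(1) gm[of N] Im by measurable
    have "norm (?d N x) \<le> norm (2 * (?I x *\<^sub>R (f x)\<^sup>2) + 2 * (B N)\<^sup>2 * ?I x)" for x
    proof -
      have "(g N x)\<^sup>2 \<le> (B N)\<^sup>2"
        using g(2)[of N x] by (simp add: abs_le_square_iff[symmetric] order.trans[OF _ abs_ge_self])
      moreover have "(f x - g N x)\<^sup>2 + (f x + g N x)\<^sup>2 = 2 * (f x)\<^sup>2 + 2 * (g N x)\<^sup>2"
        by (simp add: power2_eq_square algebra_simps)
      ultimately have "(f x - g N x)\<^sup>2 \<le> 2 * (f x)\<^sup>2 + 2 * (B N)\<^sup>2"
        using zero_le_power2[of "f x + g N x"] by linarith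
      then show ?thesis by (auto simp: indicator_def)
    qed
    then show "AE x in lebesgue. norm (?d N x) \<le> norm (2 * (?I x *\<^sub>R (f x)\<^sup>2) + 2 * (B N)\<^sup>2 * ?I x)"
      by simp
  qed
  have "norm (?d N x) = ?d N x" for N x by simp
  then have "(\<lambda>N. \<integral>x. norm (?d N x) \<partial>lebesgue) \<longlonglongrightarrow> 0"
    using L2 unfolding set_lebesgue_integral_def by presburger
  from tendsto_L1_AE_subseq[OF int this] obtain r where
    r: "strict_mono r" "AE x in lebesgue. (\<lambda>n. ?d (r n) x) \<longlonglongrightarrow> 0" by blast
  from r(2) lim show ?thesis
  proof eventually_elim
    case (elim x)
    show ?case
    proof
      assume "x \<in> {a<..<b}"
      with elim(1) have "(\<lambda>n. (f x - g (r n) x)\<^sup>2) \<longlonglongrightarrow> 0"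
        by simp
      moreover have "(\<lambda>n. (f x - g (r n) x)\<^sup>2) \<longlonglongrightarrow> (f x - h x)\<^sup>2"
        using LIMSEQ_subseq_LIMSEQ[OF elim(2) r(1)] by (intro tendsto_intros) (simp add: o_def)
      ultimately show "f x = h x"
        using LIMSEQ_unique by fastforce
    qed
  qed
qed

section \<open>The dispersion relation of the linearised Smith equation\<close>

text \<open>These are the Taylor polynomials at 0 of degree 1, 2 and 3, alternately above and below
  the root. Each comparison is made by squaring, where the difference factors with visible
  sign.\<close>

lemma sqrt_one_plus_bounds:
  fixes z :: real
  assumes "z \<ge> 0"
  shows "sqrt (1 + z) \<le> 1 + z / 2"
    and "1 + z / 2 - z\<^sup>2 / 8 \<le> sqrt (1 + z)"
    and "sqrt (1 + z) \<le> 1 + z / 2 - z\<^sup>2 / 8 + z ^ 3 / 16"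
proof -
  show "sqrt (1 + z) \<le> 1 + z / 2"
    using assms by (intro real_le_lsqrt) (auto simp: power2_eq_square algebra_simps)
  show "1 + z / 2 - z\<^sup>2 / 8 \<le> sqrt (1 + z)"
  \<comment> \<open>The factor \<open>8 - z\<close> of the difference of squares changes sign at 8;
    beyond that the polynomial is at most \<open>1 - z / 2\<close> and hence negative.\<close>
  proof (cases "z \<le> 8")
    case True
    have "1 + z - (1 + z / 2 - z\<^sup>2 / 8)\<^sup>2 = z ^ 3 * (8 - z) / 64"
      by (simp add: power2_eq_square power3_eq_cube field_simps)
    also have "\<dots> \<ge> 0" using True assms by simp
    finally show ?thesis by (intro real_le_rsqrt) simp
  next
    case False
    then have "8 * z \<le> z * z" by (intro mult_right_mono) auto
    with False have "1 + z / 2 - z\<^sup>2 / 8 \<le> 0" unfolding power2_eq_square by linarith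
    also have "0 \<le> sqrt (1 + z)" using assms by simp
    finally show ?thesis .
  qed
  show "sqrt (1 + z) \<le> 1 + z / 2 - z\<^sup>2 / 8 + z ^ 3 / 16"
  proof (rule real_le_lsqrt)
    have "1 + z / 2 - z\<^sup>2 / 8 + z ^ 3 / 16 = 1 + z * ((z - 1)\<^sup>2 + 7) / 16"
      by (simp add: power2_eq_square power3_eq_cube field_simps)
    also have "\<dots> \<ge> 0" using assms by simp
    finally show "0 \<le> 1 + z / 2 - z\<^sup>2 / 8 + z ^ 3 / 16" .
    have "(1 + z / 2 - z\<^sup>2 / 8 + z ^ 3 / 16)\<^sup>2 - (1 + z) = z ^ 4 * ((z - 2)\<^sup>2 + 16) / 256"
      by (simp add: power2_eq_square power3_eq_cube power4_eq_xxxx field_simps)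
    also have "\<dots> \<ge> 0" by simp
    finally show "1 + z \<le> (1 + z / 2 - z\<^sup>2 / 8 + z ^ 3 / 16)\<^sup>2" by simp
  qed
qed

text \<open>With \<open>z = 1 / (\<delta> * w\<^sup>2)\<close> one has
  \<open>omega_Smith \<delta> w = w\<^sup>2 * sqrt (1 + z)\<close>, and the claims are the three
  Taylor bounds multiplied by \<open>w\<^sup>2\<close>.\<close>

lemma omega_Smith_expansion:
  fixes \<delta> w :: real
  assumes "\<delta> > 0" "w > 0"
  defines "\<rho> \<equiv> w\<^sup>2 + 1 / (2 * \<delta>) - omega_Smith \<delta> w"
  shows "0 \<le> \<rho>" and "\<rho> \<le> 1 / (8 * \<delta>\<^sup>2 * w\<^sup>2)"
    and "1 / (8 * \<delta>\<^sup>2 * w\<^sup>2) - \<rho> \<le> 1 / (16 * \<delta> ^ 3 * w ^ 4)"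
proof -
  define z where "z = 1 / (\<delta> * w\<^sup>2)"
  have z: "z \<ge> 0" using assms by (simp add: z_def)
  have "1 / \<delta> + w\<^sup>2 = w\<^sup>2 * (1 + z)"
    using assms by (simp add: z_def field_simps)
  then have "omega_Smith \<delta> w = w\<^sup>2 * sqrt (1 + z)"
    using assms by (simp add: omega_Smith_def real_sqrt_mult power2_eq_square)
  moreover have "1 / (2 * \<delta>) = w\<^sup>2 * (z / 2)"
    using assms by (simp add: z_def)
  ultimately have \<rho>: "\<rho> = w\<^sup>2 * (1 + z / 2 - sqrt (1 + z))"
    by (simp add: \<rho>_def algebra_simps)
  have A: "1 / (8 * \<delta>\<^sup>2 * w\<^sup>2) = w\<^sup>2 * (z\<^sup>2 / 8)"
    using assms by (simp add: z_def power2_eq_square field_simps)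
  have B: "1 / (16 * \<delta> ^ 3 * w ^ 4) = w\<^sup>2 * (z ^ 3 / 16)"
    using assms by (simp add: z_def power2_eq_square power3_eq_cube power4_eq_xxxx field_simps)
  show "0 \<le> \<rho>"
    unfolding \<rho> using sqrt_one_plus_bounds(1)[OF z] by simp
  show "\<rho> \<le> 1 / (8 * \<delta>\<^sup>2 * w\<^sup>2)"
    unfolding \<rho> A using sqrt_one_plus_bounds(2)[OF z] by (intro mult_left_mono) auto
  have "1 / (8 * \<delta>\<^sup>2 * w\<^sup>2) - \<rho> = w\<^sup>2 * (z\<^sup>2 / 8 - (1 + z / 2 - sqrt (1 + z)))"
    unfolding \<rho> A by (simp add: algebra_simps)
  also have "\<dots> \<le> w\<^sup>2 * (z ^ 3 / 16)"
    using sqrt_one_plus_bounds(3)[OF z] by (intro mult_left_mono) auto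
  finally show "1 / (8 * \<delta>\<^sup>2 * w\<^sup>2) - \<rho> \<le> 1 / (16 * \<delta> ^ 3 * w ^ 4)"
    unfolding B .
qed

text \<open>The remainder in \<open>Taylor_exp\<close> at order 1 is divided by
  \<open>fact 1\<close>, hence no factor 1/2. This is accurate enough for the final
  constant.\<close>

lemma norm_cis_diff_linear_le: "norm (cis \<phi> - 1 - \<i> * of_real \<phi>) \<le> \<phi>\<^sup>2"
  using Taylor_exp[of "\<i> * of_real \<phi>" 1] by (simp add: cis_conv_exp norm_mult power2_eq_square diff_diff_eq)

text \<open>Two errors of order \<open>w^-4\<close> add up: linearising \<open>cis \<phi>\<close>
  costs at most \<open>\<phi>\<^sup>2 \<le> \<psi>\<^sup>2\<close>, and replacing
  \<open>\<phi>\<close> by its leading term \<open>\<psi>\<close> costs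
  \<open>\<psi> - \<phi>\<close>.\<close>

lemma norm_Smith_phase_remainder_le:
  fixes \<delta> w T :: real
  assumes "\<delta> > 0" "w > 0" "T \<ge> 0"
  shows "norm (cis (T * (w\<^sup>2 + 1 / (2 * \<delta>) - omega_Smith \<delta> w)) - 1 - \<i> * of_real (T / (8 * \<delta>\<^sup>2 * w\<^sup>2)))
      \<le> T / (16 * \<delta> ^ 3) * (1 + T / (4 * \<delta>)) / w ^ 4"
proof -
  define \<phi> where "\<phi> = T * (w\<^sup>2 + 1 / (2 * \<delta>) - omega_Smith \<delta> w)"
  define \<psi> where "\<psi> = T / (8 * \<delta>\<^sup>2 * w\<^sup>2)"
  note E = omega_Smith_expansion[OF assms(1,2)]
  have \<psi>: "\<psi> = T * (1 / (8 * \<delta>\<^sup>2 * w\<^sup>2))"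
    by (simp add: \<psi>_def)
  have 1: "0 \<le> \<phi>" "\<phi> \<le> \<psi>"
    unfolding \<phi>_def \<psi> using mult_left_mono[OF E(2) assms(3)] E(1) assms(3) by simp_all
  have "\<psi> - \<phi> = T * (1 / (8 * \<delta>\<^sup>2 * w\<^sup>2) - (w\<^sup>2 + 1 / (2 * \<delta>) - omega_Smith \<delta> w))"
    unfolding \<phi>_def \<psi> by (rule right_diff_distrib[symmetric])
  also have "\<dots> \<le> T * (1 / (16 * \<delta> ^ 3 * w ^ 4))"
    using E(3) assms(3) by (rule mult_left_mono)
  finally have 2: "\<psi> - \<phi> \<le> T * (1 / (16 * \<delta> ^ 3 * w ^ 4))" .
  have "cis \<phi> - 1 - \<i> * of_real \<psi> = (cis \<phi> - 1 - \<i> * of_real \<phi>) - \<i> * of_real (\<psi> - \<phi>)"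
    by (simp add: algebra_simps)
  then have "norm (cis \<phi> - 1 - \<i> * of_real \<psi>)
      \<le> norm (cis \<phi> - 1 - \<i> * of_real \<phi>) + norm (\<i> * of_real (\<psi> - \<phi>))"
    using norm_triangle_ineq4 by metis
  also have "\<dots> \<le> \<phi>\<^sup>2 + (\<psi> - \<phi>)"
    using norm_cis_diff_linear_le[of \<phi>] 1(2) by (simp add: norm_mult del: of_real_diff)
  also have "\<dots> \<le> \<psi>\<^sup>2 + T * (1 / (16 * \<delta> ^ 3 * w ^ 4))"
    using 1 2 by (intro add_mono power_mono) auto
  also have "\<dots> = T / (16 * \<delta> ^ 3) * (1 + T / (4 * \<delta>)) / w ^ 4"
    using assms by (simp add: \<psi>_def power2_eq_square power3_eq_cube power4_eq_xxxx field_simps)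
  finally show ?thesis
    by (simp only: \<phi>_def \<psi>_def)
qed

text \<open>What remains of the coefficient at the odd frequency \<open>w\<close> after the
  contributions of orders 1 and 3 are removed: a unimodular phase times the remainder just
  estimated, weighted by 2 / (pi w).\<close>

definition Smith_remainder_coeff :: "real \<Rightarrow> real \<Rightarrow> nat \<Rightarrow> complex" where
  "Smith_remainder_coeff \<delta> T m = (let w = real (2 * m + 1) in
     of_real (2 / pi) * cis (- (w\<^sup>2 * T + T / (2 * \<delta>)))
     * (cis (T * (w\<^sup>2 + 1 / (2 * \<delta>) - omega_Smith \<delta> w)) - 1 - \<i> * of_real (T / (8 * \<delta>\<^sup>2 * w\<^sup>2)))
     / of_real w)"

definition Smith_remainder :: "real \<Rightarrow> real \<Rightarrow> real \<Rightarrow> complex" where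
  "Smith_remainder \<delta> T x = (\<Sum>m. Smith_remainder_coeff \<delta> T m * cis (real (2 * m + 1) * x))"

lemma norm_Smith_remainder_coeff_le:
  assumes "\<delta> > 0" "T \<ge> 0"
  shows "norm (Smith_remainder_coeff \<delta> T m)
      \<le> T / (8 * pi * \<delta> ^ 3) * (1 + T / (4 * \<delta>)) * (1 / real (m * 2 + 1) ^ 5)"
proof -
  define w where "w = real (2 * m + 1)"
  have w: "w > 0" by (simp add: w_def)
  let ?R = "cis (T * (w\<^sup>2 + 1 / (2 * \<delta>) - omega_Smith \<delta> w)) - 1 - \<i> * of_real (T / (8 * \<delta>\<^sup>2 * w\<^sup>2))"
  have "norm (Smith_remainder_coeff \<delta> T m) = 2 / pi * norm ?R / w"
    unfolding Smith_remainder_coeff_def Let_def w_def[symmetric]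
    using w by (simp only: norm_mult norm_divide norm_of_real norm_cis) simp
  also have "\<dots> \<le> 2 / pi * (T / (16 * \<delta> ^ 3) * (1 + T / (4 * \<delta>)) / w ^ 4) / w"
    using w by (intro divide_right_mono mult_left_mono norm_Smith_phase_remainder_le assms) auto
  also have "\<dots> = T / (8 * pi * \<delta> ^ 3) * (1 + T / (4 * \<delta>)) * (1 / w ^ 5)"
    using w assms by (simp add: field_simps power4_eq_xxxx power3_eq_cube numeral_eq_Suc)
  finally show ?thesis by (simp add: w_def mult.commute)
qed

text \<open>The coefficients are O(\<open>w^-5\<close>), so three derivatives leave
  O(\<open>w^-2\<close>); this is where the class C^3 of the error comes from.\<close>

lemma summable_Smith_remainder_coeff:
  assumes "\<delta> > 0" "T \<ge> 0" "i \<le> 3"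
  shows "summable (\<lambda>m. norm (Smith_remainder_coeff \<delta> T m) * \<bar>real (2 * m + 1)\<bar> ^ i)"
proof (rule summable_comparison_test')
  let ?K = "T / (8 * pi * \<delta> ^ 3) * (1 + T / (4 * \<delta>))"
  show "summable (\<lambda>m. ?K * (1 / real (m * 2 + 1) ^ 2))"
    using summable_inverse_arith_power[of 2 1 2] by (intro summable_mult) simp
  fix m
  define w where "w = real (m * 2 + 1)"
  have w: "w \<ge> 1" by (simp add: w_def)
  have K: "?K \<ge> 0" using assms by simp
  have "norm (Smith_remainder_coeff \<delta> T m) * w ^ i \<le> (?K * (1 / w ^ 5)) * w ^ 3"
    using norm_Smith_remainder_coeff_le[OF assms(1,2), of m] w assms
    by (intro mult_mono power_increasing) (auto simp: w_def)
  also have "\<dots> = ?K * (1 / w ^ 2)"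
  proof -
    have "w ^ 5 = w ^ 2 * w ^ 3" by (simp flip: power_add)
    with w have "1 / w ^ 5 * w ^ 3 = 1 / w ^ 2" by (simp add: divide_simps)
    then show ?thesis by (simp only: mult.assoc)
  qed
  finally show "norm (norm (Smith_remainder_coeff \<delta> T m) * \<bar>real (2 * m + 1)\<bar> ^ i)
      \<le> ?K * (1 / real (m * 2 + 1) ^ 2)"
    by (simp add: w_def mult.commute[of 2])
qed

lemma Smith_remainder_sums:
  assumes "\<delta> > 0" "T \<ge> 0"
  shows "(\<lambda>m. Smith_remainder_coeff \<delta> T m * cis (real (2 * m + 1) * x)) sums Smith_remainder \<delta> T x"
  unfolding Smith_remainder_def
  using summable_Smith_remainder_coeff[OF assms, of 0]
  by (intro summable_sums summable_norm_cancel[of "\<lambda>m. Smith_remainder_coeff \<delta> T m * _ m"])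
     (simp add: norm_mult)

lemma cont_diff_Smith_remainder:
  assumes "\<delta> > 0" "T \<ge> 0"
  shows "cont_diff 3 (Smith_remainder \<delta> T) A"
  using cont_diff_trig_series[of 3 "Smith_remainder_coeff \<delta> T" "\<lambda>m. real (2 * m + 1)" A]
    summable_Smith_remainder_coeff[OF assms] by (simp add: Smith_remainder_def[abs_def])

lemma Smith_remainder_periodic: "Smith_remainder \<delta> T (x + 2 * pi) = Smith_remainder \<delta> T x"
proof -
  have "cis (real (2 * m + 1) * (x + 2 * pi)) = cis (real (2 * m + 1) * x)" for m
  proof -
    have "cis (real (2 * m + 1) * (x + 2 * pi)) = cis (real (2 * m + 1) * x) * cis (2 * pi * real (2 * m + 1))"
      by (simp only: cis_mult) (simp add: algebra_simps)
    also have "cis (2 * pi * real (2 * m + 1)) = 1"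
      by (intro cis_multiple_2pi Ints_of_nat)
    finally show ?thesis by simp
  qed
  then show ?thesis by (simp only: Smith_remainder_def)
qed

text \<open>The sum over odd frequencies is bounded by \<open>zeta 5\<close> term by term.
  Strictness comes from the gap between \<open>?K\<close> and the stated constant, which is positive
  as \<open>T > 0\<close>.\<close>

lemma norm_Smith_remainder_less:
  assumes "\<delta> > 0" "T > 0"
  shows "norm (Smith_remainder \<delta> T x) < T * zeta 5 / (2 * pi * \<delta> ^ 3) * (1 + T / (8 * \<delta>))"
proof -
  let ?K = "T / (8 * pi * \<delta> ^ 3) * (1 + T / (4 * \<delta>))"
  have K: "?K > 0" using assms by (intro mult_pos_pos) (auto intro!: add_pos_pos)
  have zs: "summable (\<lambda>n. 1 / real (Suc n) powr 5)"
    using summable_inverse_arith_power[of 1 1 5] by (simp add: powr_numeral)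
  have odd: "summable (\<lambda>m. 1 / real (m * 2 + 1) ^ 5)"
    using summable_inverse_arith_power[of 2 1 5] by simp
  have "(\<Sum>m. 1 / real (m * 2 + 1) ^ 5) \<le> zeta 5"
    unfolding zeta_def
  proof (rule suminf_le[OF _ odd zs])
    fix m
    have "real (Suc m) ^ 5 \<le> real (m * 2 + 1) ^ 5"
      by (intro power_mono) auto
    then have "1 / real (m * 2 + 1) ^ 5 \<le> 1 / real (Suc m) ^ 5"
      by (intro divide_left_mono) auto
    then show "1 / real (m * 2 + 1) ^ 5 \<le> 1 / real (Suc m) powr 5"
      by (simp only: powr_numeral)
  qed
  moreover have "norm (Smith_remainder \<delta> T x) \<le> (\<Sum>m. ?K * (1 / real (m * 2 + 1) ^ 5))"
    unfolding Smith_remainder_def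
    using norm_Smith_remainder_coeff_le[of \<delta> T] assms
    by (intro norm_suminf_le summable_mult odd) (simp add: norm_mult)
  ultimately have "norm (Smith_remainder \<delta> T x) \<le> ?K * zeta 5"
    using K odd by (simp only: suminf_mult) (meson mult_left_mono less_imp_le order.trans)
  moreover have "zeta 5 > 0"
    unfolding zeta_def by (rule suminf_pos[OF zs]) simp
  moreover have "?K < T / (2 * pi * \<delta> ^ 3) * (1 + T / (8 * \<delta>))"
  proof -
    have "T / (2 * pi * \<delta> ^ 3) * (1 + T / (8 * \<delta>)) - ?K = T / (8 * pi * \<delta> ^ 3) * (3 + T / (4 * \<delta>))"
      using assms by (simp add: field_simps)
    also have "\<dots> > 0"
      using assms by (intro mult_pos_pos) (auto intro!: add_pos_pos)
    finally show ?thesis by simp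
  qed
  ultimately have "norm (Smith_remainder \<delta> T x) < T / (2 * pi * \<delta> ^ 3) * (1 + T / (8 * \<delta>)) * zeta 5"
    by (meson mult_strict_right_mono order.strict_trans1)
  then show ?thesis by (simp add: mult_ac)
qed

section \<open>Odd frequencies in residue classes modulo 2q, and the exact splitting of partial
  sums\<close>

lemma sum_odd_eq_sum_residues:
  "(\<Sum>m<M * q. f (2 * m + 1)) = (\<Sum>j<q. \<Sum>n<M. f (n * (2 * q) + (2 * j + 1)))" for f :: "nat \<Rightarrow> 'a::comm_monoid_add"
proof -
  \<comment> \<open>A block of \<open>q\<close> consecutive \<open>m\<close> meets every odd residue
    modulo \<open>2 * q\<close> exactly once; the length \<open>M * q\<close> leaves no incomplete
    block.\<close>
  have "(\<Sum>m<M * q. f (2 * m + 1)) = (\<Sum>n<M. \<Sum>m=n * q..<n * q + q. f (2 * m + 1))"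
    by (rule sum.nat_group[symmetric])
  also have "\<dots> = (\<Sum>n<M. \<Sum>j<q. f (n * (2 * q) + (2 * j + 1)))"
  proof (rule sum.cong[OF refl])
    fix n
    show "(\<Sum>m=n * q..<n * q + q. f (2 * m + 1)) = (\<Sum>j<q. f (n * (2 * q) + (2 * j + 1)))"
      using sum.shift_bounds_nat_ivl[of "\<lambda>m. f (2 * m + 1)" 0 "n * q" q]
      by (simp add: atLeast0LessThan algebra_simps)
  qed
  also have "\<dots> = (\<Sum>j<q. \<Sum>n<M. f (n * (2 * q) + (2 * j + 1)))"
    by (rule sum.swap)
  finally show ?thesis .
qed

text \<open>Since \<open>w - (2 * j + 1) = 2 * q * n\<close>, the two arguments differ by
  \<open>w * 2 * q * n * p * pi / q\<close>, which is 2 pi times the natural number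
  \<open>l = n * p * w\<close>.\<close>

lemma cis_quadratic_phase:
  fixes p q n j :: nat and x :: real
  assumes "q > 0"
  defines "w \<equiv> real (n * (2 * q) + (2 * j + 1))"
  shows "cis (w * x - w\<^sup>2 * (real p * pi / real q)) = cis (w * (x - real (2 * j + 1) * real p * pi / real q))"
proof -
  define l where "l = n * p * (n * (2 * q) + (2 * j + 1))"
  have "w * (x - real (2 * j + 1) * real p * pi / real q)
      = (w * x - w\<^sup>2 * (real p * pi / real q)) + 2 * pi * real l"
    using assms(1) by (simp add: w_def l_def field_simps power2_eq_square)
  then have "cis (w * (x - real (2 * j + 1) * real p * pi / real q))
      = cis (w * x - w\<^sup>2 * (real p * pi / real q)) * cis (2 * pi * real l)"
    by (simp only: cis_mult)
  also have "cis (2 * pi * real l) = 1"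
    by (intro cis_multiple_2pi Ints_of_nat)
  finally show ?thesis by simp
qed

text \<open>An exact identity, valid for every \<open>N\<close> and every real \<open>T\<close>.
  Each phase factors as \<open>X * A * R\<close>, and \<open>R\<close> is written as 1 plus its
  linear term plus a remainder; the linear term contributes \<open>2 / pi * T / (8 *
  \<delta>\<^sup>2) = T / (4 * pi * \<delta>\<^sup>2)\<close> at order 3.\<close>

lemma riemann_partial_sum_Smith:
  assumes "\<delta> > 0"
  shows "riemann_partial_sum (omega_Smith \<delta>) N T x = 1 / 2 + Im (
      of_real (2 / pi) * cis (- (T / (2 * \<delta>)))
        * (\<Sum>m<N. cis (real (2 * m + 1) * x - (real (2 * m + 1))\<^sup>2 * T) / of_nat (2 * m + 1) ^ 1)
    + \<i> * of_real (T / (4 * pi * \<delta>\<^sup>2)) * cis (- (T / (2 * \<delta>)))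
        * (\<Sum>m<N. cis (real (2 * m + 1) * x - (real (2 * m + 1))\<^sup>2 * T) / of_nat (2 * m + 1) ^ 3)
    + (\<Sum>m<N. Smith_remainder_coeff \<delta> T m * cis (real (2 * m + 1) * x)))"
proof -
  have term_eq: "2 / pi * (sin (real (2 * m + 1) * x - omega_Smith \<delta> (real (2 * m + 1)) * T) / real (2 * m + 1))
    = Im (of_real (2 / pi) * cis (- (T / (2 * \<delta>)))
        * (cis (real (2 * m + 1) * x - (real (2 * m + 1))\<^sup>2 * T) / of_nat (2 * m + 1) ^ 1)
    + \<i> * of_real (T / (4 * pi * \<delta>\<^sup>2)) * cis (- (T / (2 * \<delta>)))
        * (cis (real (2 * m + 1) * x - (real (2 * m + 1))\<^sup>2 * T) / of_nat (2 * m + 1) ^ 3)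
    + Smith_remainder_coeff \<delta> T m * cis (real (2 * m + 1) * x))" for m
  proof -
    define w where "w = real (2 * m + 1)"
    have w: "w > 0" by (simp add: w_def)
    define X where "X = cis (w * x - w\<^sup>2 * T)"
    define A where "A = cis (- (T / (2 * \<delta>)))"
    define R where "R = cis (T * (w\<^sup>2 + 1 / (2 * \<delta>) - omega_Smith \<delta> w))"
    have split: "cis (w * x - omega_Smith \<delta> w * T) = X * A * R"
      unfolding X_def A_def R_def cis_mult by (simp add: algebra_simps)
    have XA: "cis (- (w\<^sup>2 * T + T / (2 * \<delta>))) * cis (w * x) = X * A"
      unfolding X_def A_def cis_mult by (simp add: algebra_simps)
    have "Smith_remainder_coeff \<delta> T m * cis (w * x) = of_real (2 / pi)
        * (cis (- (w\<^sup>2 * T + T / (2 * \<delta>))) * cis (w * x))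
        * (R - 1 - \<i> * of_real (T / (8 * \<delta>\<^sup>2 * w\<^sup>2))) / of_real w"
      unfolding Smith_remainder_coeff_def Let_def w_def[symmetric] R_def by (simp add: mult_ac)
    then have c: "Smith_remainder_coeff \<delta> T m * cis (w * x)
        = of_real (2 / pi) * (X * A) * (R - 1 - \<i> * of_real (T / (8 * \<delta>\<^sup>2 * w\<^sup>2))) / of_real w"
      unfolding XA .
    have r: "of_real (T / (4 * pi * \<delta>\<^sup>2)) / complex_of_real w ^ 3
        = of_real (2 / pi) * of_real (T / (8 * \<delta>\<^sup>2 * w\<^sup>2)) / of_real w"
      using w assms by (simp add: field_simps power2_eq_square power3_eq_cube)
    have "2 / pi * (sin (w * x - omega_Smith \<delta> w * T) / w)
        = Im (of_real (2 / pi) * (X * A * R) / of_real w)"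
      unfolding split[symmetric] by (simp add: Im_divide_of_real del: of_real_divide)
    also have "of_real (2 / pi) * (X * A * R) / of_real w
        = of_real (2 / pi) * A * (X / of_real w ^ 1)
          + \<i> * (of_real (2 / pi) * of_real (T / (8 * \<delta>\<^sup>2 * w\<^sup>2)) / of_real w) * A * X
          + Smith_remainder_coeff \<delta> T m * cis (w * x)"
      unfolding c using w by (simp add: field_simps)
    also have "\<i> * (of_real (2 / pi) * of_real (T / (8 * \<delta>\<^sup>2 * w\<^sup>2)) / of_real w) * A * X
        = \<i> * of_real (T / (4 * pi * \<delta>\<^sup>2)) * A * (X / of_real w ^ 3)"
      unfolding r[symmetric] by simp
    finally show ?thesis
      by (simp only: X_def A_def w_def of_real_of_nat_eq)
  qed
  show ?thesis
    unfolding riemann_partial_sum_def sum_distrib_left term_eq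
    by (simp only: sum.distrib Im_sum[symmetric])
qed

lemma cis_eq_1_iff_node:
  assumes "q > 0"
  shows "cis (real (2 * q) * x) = 1 \<longleftrightarrow> (\<exists>l. x = pi * real_of_int l / real q)"
proof -
  have "cis (real (2 * q) * x) = 1 \<longleftrightarrow> cos (real (2 * q) * x) = 1"
    by (auto simp: complex_eq_iff cos_one_sin_zero)
  also have "\<dots> \<longleftrightarrow> (\<exists>l. x = pi * real_of_int l / real q)"
    unfolding cos_one_2pi_int using assms by (intro ex_cong1) (auto simp: field_simps)
  finally show ?thesis .
qed

text \<open>Convergence is a hypothesis because at order 1 it fails at the nodes, where
  \<open>suminf\<close> is unspecified.\<close>

lemma polylog_S_eq_Im:
  assumes "(\<lambda>n. cis (real (n * k + j) * x) / of_nat (n * k + j) ^ r) sums polylog_cis k j r x"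
  shows "polylog_S k j r x = Im (polylog_cis k j r x)"
  using sums_Im[OF assms] unfolding polylog_S_def
  by (simp add: sums_iff flip: of_nat_power of_nat_add of_nat_mult)

lemma polylog_C_eq_Re:
  assumes "(\<lambda>n. cis (real (n * k + j) * x) / of_nat (n * k + j) ^ r) sums polylog_cis k j r x"
  shows "polylog_C k j r x = Re (polylog_cis k j r x)"
  using sums_Re[OF assms] unfolding polylog_C_def
  by (simp add: sums_iff flip: of_nat_power of_nat_add of_nat_mult)

section \<open>The periodic Riemann problem\<close>

lemma riemann_partial_sum_periodic:
  "riemann_partial_sum \<omega> N t (x + 2 * pi) = riemann_partial_sum \<omega> N t x"
proof -
  have "sin (real (2 * j + 1) * (x + 2 * pi) - \<omega> (real (2 * j + 1)) * t)
      = sin (real (2 * j + 1) * x - \<omega> (real (2 * j + 1)) * t)" for j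
  proof -
    have "real (2 * j + 1) * (x + 2 * pi) - \<omega> (real (2 * j + 1)) * t
      = (real (2 * j + 1) * x - \<omega> (real (2 * j + 1)) * t) + 2 * real (2 * j + 1) * pi"
      by (simp add: algebra_simps)
    then show ?thesis
      by (simp only: sin_add sin_2npi cos_2npi mult_zero_right mult_1_right add_0_right)
  qed
  then show ?thesis by (simp only: riemann_partial_sum_def)
qed

lemma continuous_riemann_partial_sum: "continuous_on A (riemann_partial_sum \<omega> N t)"
  unfolding riemann_partial_sum_def[abs_def]
  by (intro continuous_intros) auto

text \<open>A crude bound, growing with \<open>N\<close>, is enough: it serves only the
  integrability of the squared differences.\<close>

lemma abs_riemann_partial_sum_le: "\<bar>riemann_partial_sum \<omega> N t x\<bar> \<le> 1 / 2 + 2 / pi * real N"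
proof -
  have "\<bar>\<Sum>j<N. sin (real (2 * j + 1) * x - \<omega> (real (2 * j + 1)) * t) / real (2 * j + 1)\<bar>
      \<le> real N * 1"
    unfolding real_norm_def[symmetric]
  proof (rule order.trans[OF norm_sum sum_bounded_above[of "{..<N}" _ 1, simplified card_lessThan]])
    fix j
    have "\<bar>sin (real (2 * j + 1) * x - \<omega> (real (2 * j + 1)) * t)\<bar> \<le> real (2 * j + 1)"
      by (rule order.trans[OF abs_sin_le_one]) simp
    then show "norm (sin (real (2 * j + 1) * x - \<omega> (real (2 * j + 1)) * t) / real (2 * j + 1)) \<le> 1"
      by (simp add: abs_divide)
  qed
  then have "2 / pi * \<bar>\<Sum>j<N. sin (real (2 * j + 1) * x - \<omega> (real (2 * j + 1)) * t) / real (2 * j + 1)\<bar>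
      \<le> 2 / pi * real N"
    by (intro mult_left_mono) auto
  then show ?thesis
    unfolding riemann_partial_sum_def
    by (intro order.trans[OF abs_triangle_ineq]) (simp add: abs_mult)
qed

lemma periodic_riemann_solution_AE_eq:
  assumes u: "periodic_riemann_solution \<omega> u" and "t \<ge> 0"
    and r: "strict_mono r" "AE x in lebesgue. (\<lambda>N. riemann_partial_sum \<omega> (r N) t x) \<longlonglongrightarrow> v x"
  shows "AE x in lebesgue. u t x = v x"
proof -
  have L2p: "L2_periodic (u t)"
    and L2: "(\<lambda>N. LINT x:{-pi<..<pi}|lebesgue. (u t x - riemann_partial_sum \<omega> N t x)\<^sup>2) \<longlonglongrightarrow> 0"
    using u \<open>t \<ge> 0\<close> by (auto simp: periodic_riemann_solution_def)
  \<comment> \<open>\<open>v\<close> is not assumed periodic, so the equality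
    \<open>u t x = v x\<close> cannot be extended from one period directly. The predicate
    \<open>?P\<close> is periodic, and uniqueness of limits returns the equality.\<close>
  let ?P = "\<lambda>x. (\<lambda>N. riemann_partial_sum \<omega> (r N) t x) \<longlonglongrightarrow> u t x"
  have "AE x in lebesgue. x \<in> {-pi<..<pi} \<longrightarrow> u t x = v x"
    using L2p LIMSEQ_subseq_LIMSEQ[OF L2 r(1)] r(2)
    by (intro AE_eq_of_L2_limit[where g = "\<lambda>N. riemann_partial_sum \<omega> (r N) t"
          and B = "\<lambda>N. 1 / 2 + 2 / pi * real (r N)"]
        continuous_riemann_partial_sum abs_riemann_partial_sum_le)
       (auto simp: L2_periodic_def o_def)
  with r(2) have "AE x in lebesgue. x \<in> {-pi<..<pi} \<longrightarrow> ?P x"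
    by eventually_elim auto
  moreover have "?P (x + 2 * pi) = ?P x" for x
    using L2p by (simp add: riemann_partial_sum_periodic L2_periodic_def)
  ultimately have "AE x in lebesgue. ?P x"
    by (rule AE_lebesgue_periodic)
  with r(2) show ?thesis
    by eventually_elim (rule LIMSEQ_unique)
qed

theorem mainTheorem3:
  fixes \<delta> :: real and p q :: nat and u :: "real \<Rightarrow> real \<Rightarrow> real"
  assumes "\<delta> > 0" and "p > 0" and "q > 0"
    and "periodic_riemann_solution (omega_Smith \<delta>) u"
  defines "a \<equiv> real p * pi / (2 * real q * \<delta>)"
    and "y \<equiv> (\<lambda>(j::nat) (x::real). x - real (2 * j + 1) * real p * pi / real q)"
  shows "(\<exists>err \<in> Ck_per 3.
      (AE x in lebesgue. u (real p * pi / real q) x =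
         1 / 2
         + 2 / pi * cos a * (\<Sum>j<q. polylog_S (2 * q) (2 * j + 1) 1 (y j x))
         - 2 / pi * sin a * (\<Sum>j<q. polylog_C (2 * q) (2 * j + 1) 1 (y j x))
         + real p / (4 * real q * \<delta>\<^sup>2) * cos a
             * (\<Sum>j<q. polylog_C (2 * q) (2 * j + 1) 3 (y j x))
         + real p / (4 * real q * \<delta>\<^sup>2) * sin a
             * (\<Sum>j<q. polylog_S (2 * q) (2 * j + 1) 3 (y j x))
         + err x)
      \<and> (\<forall>x. \<bar>err x\<bar> < real p * zeta 5 / (2 * real q * \<delta> ^ 3)
                      * (1 + real p * pi / (8 * real q * \<delta>))))
    \<and> (\<exists>v. (AE x in lebesgue. u (real p * pi / real q) x = v x)
          \<and> Ck_on 3 v (UNIV - {pi * real_of_int l / real q |l. True}))"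
proof -
  define T where "T = real p * pi / real q"
  have T: "T > 0" using assms by (simp add: T_def)
  have a: "a = T / (2 * \<delta>)" by (simp add: a_def T_def)
  define A where "A = {x. cis (real (2 * q) * x) \<noteq> 1}"
  have A_eq: "UNIV - {pi * real_of_int l / real q |l. True} = A"
    using cis_eq_1_iff_node[OF assms(3)] by (auto simp: A_def)
  have openA: "open A"
    unfolding A_def by (rule open_not_nodes)
  \<comment> \<open>Every shift is a multiple of \<open>pi / q\<close>, so it maps nodes to nodes:
    all \<open>y j x\<close> avoid the nodes as soon as \<open>x\<close> does.\<close>
  have yA: "cis (real (2 * q) * y j x) = cis (real (2 * q) * x)" for j x
  proof -
    have "real (2 * q) * x = real (2 * q) * y j x + 2 * pi * real ((2 * j + 1) * p)"
      using assms(3) by (simp add: y_def field_simps)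
    then have "cis (real (2 * q) * x) = cis (real (2 * q) * y j x) * cis (2 * pi * real ((2 * j + 1) * p))"
      by (simp only: cis_mult)
    also have "cis (2 * pi * real ((2 * j + 1) * p)) = 1"
      by (intro cis_multiple_2pi Ints_of_nat)
    finally show ?thesis by simp
  qed
  define P where "P = (\<lambda>r x. \<Sum>j<q. polylog_cis (2 * q) (2 * j + 1) r (y j x))"
  \<comment> \<open>The limit of the complex sums of \<open>riemann_partial_sum_Smith\<close> off
    the nodes. At a node \<open>P 1\<close> has an unspecified value, which is harmless because the
    nodes form a null set outside \<open>A\<close>.\<close>
  define V where "V = (\<lambda>x. of_real (2 / pi) * cis (- a) * P 1 x
      + \<i> * of_real (T / (4 * pi * \<delta>\<^sup>2)) * cis (- a) * P 3 x + Smith_remainder \<delta> T x)"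
  define v where "v = (\<lambda>x. 1 / 2 + Im (V x))"
  define err where "err = (\<lambda>x. Im (Smith_remainder \<delta> T x))"

  have sums: "(\<lambda>n. cis (real (n * (2 * q) + (2 * j + 1)) * y j x) / of_nat (n * (2 * q) + (2 * j + 1)) ^ r)
      sums polylog_cis (2 * q) (2 * j + 1) r (y j x)" if "x \<in> A" "r = 1 \<or> r = 3" for j x r
  proof (cases "r = 1")
    case True
    have "cis (real (2 * q) * y j x) \<noteq> 1"
      using that(1) by (simp only: yA A_def mem_Collect_eq not_False_eq_True)
    then show ?thesis
      unfolding True using assms(3) by (intro polylog_cis_1_sums) auto
  next
    case False
    with that(2) assms(3) show ?thesis by (intro polylog_cis_sums) auto
  qed
  have P_lim: "(\<lambda>M. \<Sum>m<M * q. cis (real (2 * m + 1) * x - (real (2 * m + 1))\<^sup>2 * T) / of_nat (2 * m + 1) ^ r)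
      \<longlonglongrightarrow> P r x" if "x \<in> A" "r = 1 \<or> r = 3" for x r
  proof -
    have "(\<Sum>m<M * q. cis (real (2 * m + 1) * x - (real (2 * m + 1))\<^sup>2 * T) / of_nat (2 * m + 1) ^ r)
        = (\<Sum>j<q. \<Sum>n<M. cis (real (n * (2 * q) + (2 * j + 1)) * y j x) / of_nat (n * (2 * q) + (2 * j + 1)) ^ r)"
      for M
      unfolding sum_odd_eq_sum_residues[of "\<lambda>k. cis (real k * x - (real k)\<^sup>2 * T) / of_nat k ^ r"]
      unfolding T_def cis_quadratic_phase[OF assms(3)] y_def ..
    then show ?thesis
      unfolding P_def using sums[OF that] by (auto simp: sums_def intro!: tendsto_sum)
  qed
  have E_lim: "(\<lambda>M. \<Sum>m<M * q. Smith_remainder_coeff \<delta> T m * cis (real (2 * m + 1) * x))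
      \<longlonglongrightarrow> Smith_remainder \<delta> T x" for x
  proof -
    have "strict_mono (\<lambda>M. M * q)" using assms(3) by (auto intro: strict_monoI)
    from LIMSEQ_subseq_LIMSEQ[OF _ this] show ?thesis
      using Smith_remainder_sums[OF assms(1) less_imp_le[OF T], of x] by (simp add: sums_def o_def)
  qed
  have lim: "(\<lambda>M. riemann_partial_sum (omega_Smith \<delta>) (M * q) T x) \<longlonglongrightarrow> v x" if "x \<in> A" for x
    unfolding riemann_partial_sum_Smith[OF assms(1)] v_def V_def a
    by (intro tendsto_add tendsto_const tendsto_Im tendsto_mult P_lim E_lim that) simp_all

  have "countable {pi * real_of_int l / real q |l. True}"
    by (simp add: full_SetCompr_eq)
  then have "AE x in lebesgue. x \<notin> {pi * real_of_int l / real q |l. True}"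
    by (intro AE_not_in null_sets_completionI countable_imp_null_set_lborel)
  then have AE_A: "AE x in lebesgue. x \<in> A"
    by eventually_elim (use A_eq in blast)
  have AE_v: "AE x in lebesgue. u T x = v x"
  proof (rule periodic_riemann_solution_AE_eq[OF assms(4) less_imp_le[OF T]])
    show "strict_mono (\<lambda>M. M * q)" using assms(3) by (auto intro: strict_monoI)
    show "AE x in lebesgue. (\<lambda>M. riemann_partial_sum (omega_Smith \<delta>) (M * q) T x) \<longlonglongrightarrow> v x"
      using AE_A by eventually_elim (rule lim)
  qed

  have v_eq: "v x = 1 / 2
         + 2 / pi * cos a * (\<Sum>j<q. polylog_S (2 * q) (2 * j + 1) 1 (y j x))
         - 2 / pi * sin a * (\<Sum>j<q. polylog_C (2 * q) (2 * j + 1) 1 (y j x))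
         + real p / (4 * real q * \<delta>\<^sup>2) * cos a
             * (\<Sum>j<q. polylog_C (2 * q) (2 * j + 1) 3 (y j x))
         + real p / (4 * real q * \<delta>\<^sup>2) * sin a
             * (\<Sum>j<q. polylog_S (2 * q) (2 * j + 1) 3 (y j x))
         + err x" if "x \<in> A" for x
  proof -
    have S: "(\<Sum>j<q. polylog_S (2 * q) (2 * j + 1) r (y j x)) = Im (P r x)"
      and C: "(\<Sum>j<q. polylog_C (2 * q) (2 * j + 1) r (y j x)) = Re (P r x)" if "r = 1 \<or> r = 3" for r
      unfolding P_def Im_sum Re_sum
      by (intro sum.cong refl polylog_S_eq_Im polylog_C_eq_Re sums that \<open>x \<in> A\<close>)+
    have K: "T / (4 * pi * \<delta>\<^sup>2) = real p / (4 * real q * \<delta>\<^sup>2)"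
      by (simp add: T_def)
    \<comment> \<open>The factor \<open>cis (- a)\<close> yields the minus sign at order 1; the
      additional \<open>\<i>\<close> at order 3 exchanges the roles of sine and cosine series and
      makes both signs positive.\<close>
    have Im_mult_real: "Im (of_real s * cis (- a) * w) = s * cos a * Im w - s * sin a * Re w"
      "Im (\<i> * of_real s * cis (- a) * w) = s * cos a * Re w + s * sin a * Im w" for s w
      by (simp_all add: algebra_simps)
    show ?thesis
      unfolding S[OF disjI1[OF refl]] S[OF disjI2[OF refl]] C[OF disjI1[OF refl]] C[OF disjI2[OF refl]]
        v_def V_def err_def K[symmetric] plus_complex.sel Im_mult_real by linarith
  qed

  have err_smooth: "cont_diff 3 (Smith_remainder \<delta> T) B" for B
    using cont_diff_Smith_remainder assms(1) T by simp
  have "err \<in> Ck_per 3"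
    unfolding err_def
    by (intro Ck_per_cont_diffI cont_diff_bounded_linear[OF bounded_linear_Im] err_smooth)
       (simp add: Smith_remainder_periodic)
  moreover have "\<bar>err x\<bar> < real p * zeta 5 / (2 * real q * \<delta> ^ 3) * (1 + real p * pi / (8 * real q * \<delta>))" for x
  proof -
    have "\<bar>err x\<bar> \<le> norm (Smith_remainder \<delta> T x)"
      unfolding err_def by (rule abs_Im_le_cmod)
    also have "\<dots> < T * zeta 5 / (2 * pi * \<delta> ^ 3) * (1 + T / (8 * \<delta>))"
      by (rule norm_Smith_remainder_less[OF assms(1) T])
    also have "\<dots> = real p * zeta 5 / (2 * real q * \<delta> ^ 3) * (1 + real p * pi / (8 * real q * \<delta>))"
      by (simp add: T_def mult_ac)
    finally show ?thesis .
  qed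
  moreover have "AE x in lebesgue. u T x = 1 / 2
         + 2 / pi * cos a * (\<Sum>j<q. polylog_S (2 * q) (2 * j + 1) 1 (y j x))
         - 2 / pi * sin a * (\<Sum>j<q. polylog_C (2 * q) (2 * j + 1) 1 (y j x))
         + real p / (4 * real q * \<delta>\<^sup>2) * cos a
             * (\<Sum>j<q. polylog_C (2 * q) (2 * j + 1) 3 (y j x))
         + real p / (4 * real q * \<delta>\<^sup>2) * sin a
             * (\<Sum>j<q. polylog_S (2 * q) (2 * j + 1) 3 (y j x))
         + err x"
    using AE_v AE_A
  proof eventually_elim
    case (elim x)
    then show ?case using v_eq[of x] by simp
  qed
  moreover have "Ck_on 3 v A"
  proof -
    have shift: "cont_diff 3 (\<lambda>x. f (y j x)) A"
      if "cont_diff 3 f {x. cis (real (2 * q) * x) \<noteq> 1}" for f :: "real \<Rightarrow> complex" and j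
      using cont_diff_shift[OF that, of "real (2 * j + 1) * real p * pi / real q"] yA[of j]
      unfolding A_def y_def by simp
    have P_smooth: "cont_diff 3 (P 1) A" "cont_diff 3 (P 3) A"
      unfolding P_def using assms(3)
      by (intro cont_diff_sum shift cont_diff_polylog_cis_1 cont_diff_polylog_cis_3; simp)+
    show ?thesis
      unfolding v_def V_def
      by (intro cont_diff_imp_Ck_on openA cont_diff_add cont_diff_const
          cont_diff_bounded_linear[OF bounded_linear_Im] cont_diff_mult P_smooth err_smooth)
  qed
  ultimately show ?thesis
    using AE_v unfolding A_eq T_def[symmetric] by blast
qed

end
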